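(* Let $X=Y\oplus Z$, $(e_j)$, $Y_k$, $Z_k$ and $\tau$ be as defined in the context. Suppose that a finite group $G$ acts isometrically and $\tau$-isometrically on $X$, that every closed subspace of $X$ is $G$-invariant, and that the action of $G$ on every closed subspace of $X$ is admissible. Let $\varphi\in\mathcal{C}^1(X,\mathbb{R})$ be invariant and $\tau$-upper semicontinuous and such that $\nabla\varphi$ is weakly sequentially continuous. Suppose that for every $k\ge2$ there exist $\rho_k>r_k>0$ such that ($A_2$) $a_k:=\sup_{u\in Y_k,\ \|u\|=\rho_k}\varphi(u)\le0$ and $d_k:=\sup_{u\in Y_k,\ \|u\|\le\rho_k}\varphi(u)<\infty$; ($A_3$) $b_k:=\inf_{u\in Z_k,\ \|u\|=r_k}\varphi(u)\to\infty$ as $k\to\infty$. If in addition $\varphi$ satisfies the $(PS)_c$ condition for every $c>0$, then $\varphi$ has an unbounded sequence of critical values.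
   Context: Setting. $X$ is a real Hilbert space with inner product $(\cdot,\cdot)$ and norm $\|\cdot\|$; $Y\subset X$ is a closed separable subspace (possibly infinite-dimensional), $Z:=Y^\perp=\overline{\bigoplus_{j=0}^\infty\mathbb{R}e_j}$ with $(e_j)_{j\ge0}$ orthonormal. For $k\ge2$, $Y_k:=Y\oplus\big(\bigoplus_{j=0}^k\mathbb{R}e_j\big)$ and $Z_k:=\overline{\bigoplus_{j=k}^\infty\mathbb{R}e_j}$. $\varphi$ satisfies the $(PS)_c$ condition if every sequence $(u_n)\subset X$ such that $\varphi(u_n)\to c$ and $\varphi'(u_n)\to0$ as $n\to\infty$ has a convergent subsequence. Topology $\tau$. With $P:X\to Y$, $Q:X\to Z$ the orthogonal projections and $(\theta_j)_{j\ge0}$ a fixed orthonormal basis of $Y$ (finite if $\dim Y<\infty$), $\tau$ is the topology on $X$ generated by the norm $|||u|||:=\max\big(\sum_j 2^{-(j+1)}|(Pu,\theta_j)|,\|Qu\|\big)$. Weakly sequentially continuous means: $u_n\rightharpoonup u$ implies $\nabla\varphi(u_n)\rightharpoonup\nabla\varphi(u)$. Group actions. An action of a topological group $G$ on a normed space $E$ is a continuous map $G\times E\to E$, $(g,u)\mapsto gu$, with $eu=u$, $h(gu)=(hg)u$, and $u\mapsto gu$ linear. It is isometric if $\|gu\|=\|u\|$, and $\tau$-isometric (on $X$) if $|||gu|||=|||u|||$. A set $F$ is invariant if $gF=F$ for all $g\in G$; $\varphi$ is invariant if $\varphi(gu)=\varphi(u)$; a map $f$ is equivariant if $f(gu)=gf(u)$.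 Admissibility. Let $\mathcal{H}$ be a separable Hilbert space with a total orthonormal sequence $(b_j)$ (finite if $\dim\mathcal H<\infty$), and let $\sigma$ be the topology generated by $\|u\|_1:=\sum_j 2^{-(j+1)}|(u,b_j)|$. For $U\subset\mathcal{H}$ open bounded with $\overline U$ $\sigma$-closed, a map $f:\overline U\to\mathcal H$ is $\sigma$-admissible if it is $\sigma$-continuous (with $\sigma$ on source and target) and each $u\in U$ has a $\sigma$-neighborhood $N_u$ such that $(\mathrm{id}-f)(N_u\cap U)$ is contained in a finite-dimensional subspace of $\mathcal H$. The action of a finite group $G$ on $\mathcal H$ is admissible if $\{u\in\mathcal H: gu=u\ \forall g\in G\}=\{0\}$ and, for every open bounded invariant neighborhood $U$ of the origin in $\mathcal H$ with $\overline U$ $\sigma$-closed and every proper subspace $\mathcal H_0$ of $\mathcal H$, every $\sigma$-admissible equivariant map $f:\overline U\to\mathcal H_0$ has a zero on $\partial U$. For a closed subspace of $X$ in the role of $\mathcal{H}$, admissibility is required for any choice of total orthonormal sequence $(b_j)$ of that subspace. *)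

theory Defs
  imports "HOL-Algebra.Group_Action" "HOL-Analysis.Analysis"
begin

text \<open>
  An orthonormal sequence \<open>b\<close> that is total in \<open>V\<close>. The index set \<open>J\<close> is an initial segment of
  \<open>\<nat>\<close> or all of \<open>\<nat>\<close>, so that finite-dimensional and infinite-dimensional \<open>V\<close> are treated alike;
  the values of \<open>b\<close> outside \<open>J\<close> are irrelevant.
\<close>

definition total_orthonormal :: "'a::real_inner set \<Rightarrow> nat set \<Rightarrow> (nat \<Rightarrow> 'a) \<Rightarrow> bool" where
  "total_orthonormal V J b \<longleftrightarrow>
     (J = UNIV \<or> (\<exists>n. J = {..<n})) \<and>
     (\<forall>i\<in>J. \<forall>j\<in>J. b i \<bullet> b j = (if i = j then 1 else 0)) \<and>
     closure (span (b ` J)) = V"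

definition orth_proj :: "'a::real_inner set \<Rightarrow> 'a \<Rightarrow> 'a" where
  "orth_proj V u = (THE p. p \<in> V \<and> u - p \<in> orthogonal_comp V)"

definition weak_lim :: "(nat \<Rightarrow> 'a::real_inner) \<Rightarrow> 'a \<Rightarrow> bool" where
  "weak_lim u l \<longleftrightarrow> (\<forall>v. (\<lambda>n. u n \<bullet> v) \<longlonglongrightarrow> l \<bullet> v)"

definition weakly_seq_continuous :: "('a::real_inner \<Rightarrow> 'b::real_inner) \<Rightarrow> bool" where
  "weakly_seq_continuous F \<longleftrightarrow> (\<forall>u l. weak_lim u l \<longrightarrow> weak_lim (\<lambda>n. F (u n)) (F l))"

definition norm_topology :: "'a::ab_group_add set \<Rightarrow> ('a \<Rightarrow> real) \<Rightarrow> 'a topology" where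
  "norm_topology V N = Metric_space.mtopology V (\<lambda>u v. N (u - v))"

definition weighted_norm :: "nat set \<Rightarrow> (nat \<Rightarrow> 'a::real_inner) \<Rightarrow> 'a \<Rightarrow> real" where
  "weighted_norm J b u = (\<Sum>\<^sub>\<infinity>j\<in>J. (1 / 2) ^ (j + 1) * \<bar>u \<bullet> b j\<bar>)"

definition sigma_topology :: "'a::real_inner set \<Rightarrow> nat set \<Rightarrow> (nat \<Rightarrow> 'a) \<Rightarrow> 'a topology" where
  "sigma_topology H J b = norm_topology H (weighted_norm J b)"

definition tau_norm :: "'a::real_inner set \<Rightarrow> nat set \<Rightarrow> (nat \<Rightarrow> 'a) \<Rightarrow> 'a \<Rightarrow> real" where
  "tau_norm Y J \<theta> u =
     max (weighted_norm J \<theta> (orth_proj Y u)) (norm (orth_proj (orthogonal_comp Y) u))"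

definition tau_topology :: "'a::real_inner set \<Rightarrow> nat set \<Rightarrow> (nat \<Rightarrow> 'a) \<Rightarrow> 'a topology" where
  "tau_topology Y J \<theta> = norm_topology UNIV (tau_norm Y J \<theta>)"

definition upper_semicontinuous :: "'a topology \<Rightarrow> ('a \<Rightarrow> real) \<Rightarrow> bool" where
  "upper_semicontinuous T f \<longleftrightarrow> (\<forall>c. openin T {u \<in> topspace T. f u < c})"

definition fderiv :: "('a::real_normed_vector \<Rightarrow> real) \<Rightarrow> 'a \<Rightarrow> 'a \<Rightarrow>\<^sub>L real" where
  "fderiv \<phi> u = Blinfun (frechet_derivative \<phi> (at u))"

definition C1 :: "('a::real_normed_vector \<Rightarrow> real) \<Rightarrow> bool" where
  "C1 \<phi> \<longleftrightarrow> (\<forall>u. \<phi> differentiable (at u)) \<and> continuous_on UNIV (fderiv \<phi>)"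

definition grad :: "('a::real_inner \<Rightarrow> real) \<Rightarrow> 'a \<Rightarrow> 'a" where
  "grad \<phi> u = (THE D. GDERIV \<phi> u :> D)"

definition palais_smale :: "('a::real_normed_vector \<Rightarrow> real) \<Rightarrow> real \<Rightarrow> bool" where
  "palais_smale \<phi> c \<longleftrightarrow>
     (\<forall>u. (\<lambda>n. \<phi> (u n)) \<longlonglongrightarrow> c \<and> (\<lambda>n. fderiv \<phi> (u n)) \<longlonglongrightarrow> 0 \<longrightarrow>
        (\<exists>s::nat \<Rightarrow> nat. strict_mono s \<and> convergent (u \<circ> s)))"

definition critical_value :: "('a::real_normed_vector \<Rightarrow> real) \<Rightarrow> real \<Rightarrow> bool" where
  "critical_value \<phi> c \<longleftrightarrow> (\<exists>u. \<phi> u = c \<and> fderiv \<phi> u = 0)"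

text \<open>
  Finite groups carry the discrete topology.
\<close>

definition linear_action ::
    "('g, 'm) monoid_scheme \<Rightarrow> ('g \<Rightarrow> 'a::real_normed_vector \<Rightarrow> 'a) \<Rightarrow> bool" where
  "linear_action G act \<longleftrightarrow>
     group_action G UNIV act \<and>
     continuous_map (prod_topology (discrete_topology (carrier G)) euclidean) euclidean
       (\<lambda>(g, u). act g u) \<and>
     (\<forall>g\<in>carrier G. linear (act g))"

definition invariant_set ::
    "('g, 'm) monoid_scheme \<Rightarrow> ('g \<Rightarrow> 'a \<Rightarrow> 'a) \<Rightarrow> 'a set \<Rightarrow> bool" where
  "invariant_set G act F \<longleftrightarrow> (\<forall>g\<in>carrier G. act g ` F = F)"

definition invariant_fun ::
    "('g, 'm) monoid_scheme \<Rightarrow> ('g \<Rightarrow> 'a \<Rightarrow> 'a) \<Rightarrow> ('a \<Rightarrow> 'b) \<Rightarrow> bool" where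
  "invariant_fun G act f \<longleftrightarrow> (\<forall>g\<in>carrier G. \<forall>u. f (act g u) = f u)"

definition equivariant_on ::
    "('g, 'm) monoid_scheme \<Rightarrow> ('g \<Rightarrow> 'a \<Rightarrow> 'a) \<Rightarrow> 'a set \<Rightarrow> ('a \<Rightarrow> 'a) \<Rightarrow> bool" where
  "equivariant_on G act S f \<longleftrightarrow> (\<forall>g\<in>carrier G. \<forall>u\<in>S. f (act g u) = act g (f u))"

text \<open>
  In the following, \<open>H\<close> is a closed subspace of the ambient Hilbert space, so that the closure of a
  subset of \<open>H\<close> relative to \<open>H\<close> is its closure in the ambient space. Boundaries are taken
  relative to \<open>H\<close>.
\<close>

definition sigma_admissible ::
    "'a::real_inner set \<Rightarrow> nat set \<Rightarrow> (nat \<Rightarrow> 'a) \<Rightarrow> 'a set \<Rightarrow> ('a \<Rightarrow> 'a) \<Rightarrow> bool" where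
  "sigma_admissible H J b U f \<longleftrightarrow>
     continuous_map (subtopology (sigma_topology H J b) (closure U)) (sigma_topology H J b) f \<and>
     (\<forall>u\<in>U. \<exists>N. openin (sigma_topology H J b) N \<and> u \<in> N \<and>
        (\<exists>B. finite B \<and> B \<subseteq> H \<and> (\<lambda>x. x - f x) ` (N \<inter> U) \<subseteq> span B))"

definition admissible_action ::
    "('g, 'm) monoid_scheme \<Rightarrow> ('g \<Rightarrow> 'a \<Rightarrow> 'a) \<Rightarrow> 'a::real_inner set \<Rightarrow>
     nat set \<Rightarrow> (nat \<Rightarrow> 'a) \<Rightarrow> bool" where
  "admissible_action G act H J b \<longleftrightarrow>
     {u \<in> H. \<forall>g\<in>carrier G. act g u = u} = {0} \<and>
     (\<forall>U H0 f.
        openin (top_of_set H) U \<and> bounded U \<and> 0 \<in> U \<and> invariant_set G act U \<and>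
        closedin (sigma_topology H J b) (closure U) \<and>
        subspace H0 \<and> H0 \<subset> H \<and>
        sigma_admissible H J b U f \<and> f ` closure U \<subseteq> H0 \<and>
        equivariant_on G act (closure U) f \<longrightarrow>
        (\<exists>u \<in> top_of_set H frontier_of U. f u = 0))"

definition Yk :: "'a::real_inner set \<Rightarrow> (nat \<Rightarrow> 'a) \<Rightarrow> nat \<Rightarrow> 'a set" where
  "Yk Y e k = {y + z | y z. y \<in> Y \<and> z \<in> span (e ` {0..k})}"

definition Zk :: "(nat \<Rightarrow> 'a::real_inner) \<Rightarrow> nat \<Rightarrow> 'a set" where
  "Zk e k = closure (span (e ` {k..}))"

end

theory Submission
  imports Defs
begin

text \<open>
  An isometry that preserves every line is \<open>\<plusminus>id\<close>, and admissibility on a line excludes that all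
  group elements act as the identity; so the hypotheses say that \<open>\<phi>\<close> is even, and admissibility
  on finite-dimensional subspaces is the Borsuk--Ulam theorem.

  Suppose that there is no critical value in \<open>[B, \<infinity>)\<close> with \<open>B > 0\<close>, and choose \<open>k\<close> with
  \<open>b\<^sub>k > B\<close>. By the Palais--Smale condition \<open>\<parallel>\<nabla>\<phi>\<parallel> \<ge> \<delta> > 0\<close> where \<open>B \<le> \<phi> \<le> d\<^sub>k\<close>. The ball of
  \<open>Y\<^sub>k\<close> is a compact set \<open>D\<close> of coordinate sequences. Consider the maps
  \<open>g : [0, 1] \<times> D \<rightarrow> X\<close> that are continuous for the norm of \<open>X\<close>, odd in the second argument, zero
  at time \<open>0\<close>, and such that \<open>u - g(t, u)\<close> never lies higher than \<open>u\<close>. They form a complete space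
  for the uniform distance. For each of them a Galerkin argument shows that \<open>u - g(1, u)\<close> meets the
  sphere of radius \<open>r\<^sub>k\<close> in \<open>Z\<^sub>k\<close>, so that the maximal height at time \<open>1\<close> exceeds \<open>B\<close>. On the other
  hand, weak continuity of \<open>\<nabla>\<phi>\<close> and a partition of unity on \<open>[0, 1] \<times> D\<close> yield a modification of
  \<open>g\<close> by at most \<open>s\<close> that lowers the maximal height by \<open>s \<delta> / 2\<close>. By the Brezis--Browder ordering
  principle both cannot hold.
\<close>

section \<open>Closed subspaces of a Hilbert space\<close>

lemma subspace_closure:
  fixes S :: "'a::real_normed_vector set"
  assumes S: "subspace S"
  shows "subspace (closure S)"
  unfolding subspace_def
proof (intro conjI ballI allI)
  show "0 \<in> closure S"
    using subspace_0[OF S] closure_subset by blast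
next
  fix x y assume "x \<in> closure S" "y \<in> closure S"
  then obtain f g where "\<forall>n. f n \<in> S" "f \<longlonglongrightarrow> x" "\<forall>n. g n \<in> S" "g \<longlonglongrightarrow> y"
    unfolding closure_sequential by blast
  then show "x + y \<in> closure S"
    unfolding closure_sequential
    by (intro exI[where x="\<lambda>n. f n + g n"]) (auto intro: tendsto_add subspace_add[OF S])
next
  fix c x assume "x \<in> closure S"
  then obtain f where "\<forall>n. f n \<in> S" "f \<longlonglongrightarrow> x"
    unfolding closure_sequential by blast
  then show "c *\<^sub>R x \<in> closure S"
    unfolding closure_sequential
    by (intro exI[where x="\<lambda>n. c *\<^sub>R f n"]) (auto intro: tendsto_scaleR subspace_scale[OF S])
qed

lemma parallelogram_law:
  fixes a b :: "'a::real_inner"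
  shows "(norm (a + b))\<^sup>2 + (norm (a - b))\<^sup>2 = 2 * (norm a)\<^sup>2 + 2 * (norm b)\<^sup>2"
  by (simp add: power2_norm_eq_inner inner_simps inner_commute)

text \<open>The projection is the limit of a minimising sequence for the distance to
  \<open>u\<close>. Midpoints of its members stay in \<open>V\<close>, so the parallelogram law
  makes the sequence Cauchy.\<close>

lemma orthogonal_projection_exists:
  fixes V :: "'a::{real_inner, complete_space} set"
  assumes V: "subspace V" "closed V"
  shows "\<exists>p\<in>V. u - p \<in> orthogonal_comp V"
proof -
  define q where "q = (INF p\<in>V. (norm (u - p))\<^sup>2)"
  have V0: "V \<noteq> {}"
    using subspace_0[OF V(1)] by auto
  have bdd: "bdd_below ((\<lambda>p. (norm (u - p))\<^sup>2) ` V)"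
    by (auto intro!: bdd_belowI2[where m=0])
  have q_le: "q \<le> (norm (u - p))\<^sup>2" if "p \<in> V" for p
    unfolding q_def using bdd that by (rule cINF_lower)
  have "\<exists>p\<in>V. (norm (u - p))\<^sup>2 < q + inverse (real (Suc n))" for n
    using cINF_less_iff[OF V0 bdd, of "q + inverse (real (Suc n))"] unfolding q_def by simp
  then obtain p where p: "\<And>n. p n \<in> V" "\<And>n. (norm (u - p n))\<^sup>2 < q + inverse (real (Suc n))"
    by metis
  have dist2: "(dist (p m) (p n))\<^sup>2 \<le> 2 * inverse (real (Suc m)) + 2 * inverse (real (Suc n))" for m n
  proof -
    have "(1/2) *\<^sub>R (p m + p n) \<in> V"
      using V(1) p(1) by (simp add: subspace_add subspace_scale)
    then have "4 * q \<le> 4 * (norm (u - (1/2) *\<^sub>R (p m + p n)))\<^sup>2"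
      using q_le by simp
    also have "\<dots> = (norm (2 *\<^sub>R (u - (1/2) *\<^sub>R (p m + p n))))\<^sup>2"
      by (simp add: power_mult_distrib)
    also have "2 *\<^sub>R (u - (1/2) *\<^sub>R (p m + p n)) = (u - p m) + (u - p n)"
      by (simp add: algebra_simps scaleR_2)
    finally have "(norm ((u - p m) - (u - p n)))\<^sup>2 \<le> 2 * (norm (u - p m))\<^sup>2 + 2 * (norm (u - p n))\<^sup>2 - 4 * q"
      using parallelogram_law[of "u - p m" "u - p n"] by linarith
    then show ?thesis
      using p(2)[of m] p(2)[of n] by (simp add: dist_norm norm_minus_commute)
  qed
  have "Cauchy p"
  proof (rule metric_CauchyI)
    fix \<epsilon> :: real assume "\<epsilon> > 0"
    then obtain N where N: "inverse (real (Suc N)) < \<epsilon>\<^sup>2 / 4"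
      using reals_Archimedean[of "\<epsilon>\<^sup>2 / 4"] by auto
    have "dist (p m) (p n) < \<epsilon>" if "m \<ge> N" "n \<ge> N" for m n
    proof -
      have "inverse (real (Suc m)) \<le> inverse (real (Suc N))" "inverse (real (Suc n)) \<le> inverse (real (Suc N))"
        using that by (auto intro!: le_imp_inverse_le)
      then have "(dist (p m) (p n))\<^sup>2 < \<epsilon>\<^sup>2"
        using dist2[of m n] N by linarith
      then show ?thesis
        using \<open>\<epsilon> > 0\<close> by (simp add: power_less_imp_less_base)
    qed
    then show "\<exists>M. \<forall>m\<ge>M. \<forall>n\<ge>M. dist (p m) (p n) < \<epsilon>"
      by blast
  qed
  then obtain l where l: "p \<longlonglongrightarrow> l"
    using Cauchy_convergent convergent_def by blast
  have lV: "l \<in> V"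
    using closed_sequentially[OF V(2) _ l] p(1) by blast
  have lim_q: "(\<lambda>n. q + inverse (real (Suc n))) \<longlonglongrightarrow> q + 0"
    by (intro tendsto_intros LIMSEQ_inverse_real_of_nat)
  have lim_n: "(\<lambda>n. (norm (u - p n))\<^sup>2) \<longlonglongrightarrow> (norm (u - l))\<^sup>2"
    by (intro tendsto_intros l)
  have lq: "(norm (u - l))\<^sup>2 \<le> q"
    using LIMSEQ_le[OF lim_n lim_q] less_imp_le[OF p(2)] by auto
  have "v \<bullet> (u - l) = 0" if v: "v \<in> V" for v
  proof (rule ccontr)
    assume ne: "v \<bullet> (u - l) \<noteq> 0"
    \<comment> \<open>This \<open>t\<close> minimises the norm of
      \<open>(u - l) - t *\<^sub>R v\<close>; were the inner product nonzero,
      \<open>l + t *\<^sub>R v\<close> would be closer to \<open>u\<close> than the minimiser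
      \<open>l\<close>.\<close>
    define t where "t = v \<bullet> (u - l) / (v \<bullet> v)"
    have vv: "v \<bullet> v > 0"
      using ne by auto
    have "l + t *\<^sub>R v \<in> V"
      using V(1) lV v by (simp add: subspace_add subspace_scale)
    then have "(norm (u - l))\<^sup>2 \<le> (norm ((u - l) - t *\<^sub>R v))\<^sup>2"
      using order_trans[OF lq q_le] by (metis diff_diff_eq)
    also have "\<dots> = (norm (u - l))\<^sup>2 - 2 * t * (v \<bullet> (u - l)) + t * t * (v \<bullet> v)"
      by (simp add: power2_norm_eq_inner inner_simps inner_commute algebra_simps)
    also have "t * t * (v \<bullet> v) = t * (v \<bullet> (u - l))"
      using vv by (simp add: t_def)
    finally have "t * (v \<bullet> (u - l)) \<le> 0"
      by linarith
    moreover have "t * (v \<bullet> (u - l)) = (v \<bullet> (u - l))\<^sup>2 / (v \<bullet> v)"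
      by (simp add: t_def power2_eq_square)
    moreover have "(v \<bullet> (u - l))\<^sup>2 / (v \<bullet> v) > 0"
      using ne vv by simp
    ultimately show False
      by linarith
  qed
  then have "u - l \<in> orthogonal_comp V"
    by (simp add: orthogonal_comp_def orthogonal_def)
  then show ?thesis
    using lV by blast
qed

lemma orth_proj_unique:
  fixes V :: "'a::real_inner set"
  assumes "subspace V" "p \<in> V" "u - p \<in> orthogonal_comp V"
  shows "orth_proj V u = p"
  unfolding orth_proj_def
proof (rule the_equality)
  fix p' assume p': "p' \<in> V \<and> u - p' \<in> orthogonal_comp V"
  then have "p - p' \<in> V"
    using assms by (simp add: subspace_diff)
  moreover have "p - p' = (u - p') - (u - p)"
    by simp
  then have "p - p' \<in> orthogonal_comp V"
    using assms p' subspace_diff[OF subspace_orthogonal_comp] by metis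
  ultimately have "(p - p') \<bullet> (p - p') = 0"
    unfolding orthogonal_comp_def orthogonal_def by blast
  then show "p' = p"
    by simp
qed (use assms in auto)

lemma orth_proj_orthogonal_comp:
  fixes V :: "'a::{real_inner, complete_space} set"
  assumes "subspace V" "closed V"
  shows "orth_proj (orthogonal_comp V) u = u - orth_proj V u"
proof -
  obtain p where p: "p \<in> V" "u - p \<in> orthogonal_comp V"
    using orthogonal_projection_exists[OF assms] by blast
  have "orth_proj (orthogonal_comp V) u = u - p"
    using p orthogonal_comp_subset[of V]
    by (intro orth_proj_unique subspace_orthogonal_comp) auto
  then show ?thesis
    using orth_proj_unique[OF assms(1) p] by simp
qed

context
  fixes V :: "'a::{real_inner, complete_space} set"
  assumes V: "subspace V" "closed V"
begin

lemma orth_proj_in: "orth_proj V u \<in> V"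
  and orth_proj_compl: "u - orth_proj V u \<in> orthogonal_comp V"
  using orthogonal_projection_exists[OF V, of u] orth_proj_unique[OF V(1)] by auto

lemma inner_orth_proj: "v \<in> V \<Longrightarrow> orth_proj V u \<bullet> v = u \<bullet> v"
  using orth_proj_compl[of u]
  by (auto simp: orthogonal_comp_def orthogonal_def inner_commute inner_diff_right)

lemma orth_proj_diff: "orth_proj V (u - v) = orth_proj V u - orth_proj V v"
proof (rule orth_proj_unique[OF V(1)])
  have "(u - v) - (orth_proj V u - orth_proj V v) = (u - orth_proj V u) - (v - orth_proj V v)"
    by simp
  then show "(u - v) - (orth_proj V u - orth_proj V v) \<in> orthogonal_comp V"
    using orth_proj_compl subspace_diff[OF subspace_orthogonal_comp] by metis
qed (simp add: V orth_proj_in subspace_diff)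

lemma norm_orth_proj_le: "norm (orth_proj V u) \<le> norm u"
proof -
  have "(norm (orth_proj V u))\<^sup>2 = u \<bullet> orth_proj V u"
    using inner_orth_proj[OF orth_proj_in, of u u] by (simp add: power2_norm_eq_inner)
  also have "\<dots> \<le> norm u * norm (orth_proj V u)"
    by (rule norm_cauchy_schwarz)
  finally show ?thesis
    by (cases "norm (orth_proj V u) = 0") (auto simp: power2_eq_square)
qed

end

text \<open>Let \<open>z\<close> be the component orthogonal to the kernel of some vector outside
  it. Every \<open>x\<close> differs from a multiple of \<open>z\<close> by an element of the
  kernel, so \<open>L\<close> is a multiple of the inner product with \<open>z\<close>.\<close>

lemma riesz_representation:
  fixes L :: "'a::{real_inner, complete_space} \<Rightarrow> real"
  assumes L: "bounded_linear L"
  shows "\<exists>w. \<forall>x. L x = x \<bullet> w"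
proof (cases "\<forall>x. L x = 0")
  case True
  then show ?thesis
    by (auto intro: exI[where x=0])
next
  case False
  then obtain u where u: "L u \<noteq> 0"
    by blast
  interpret L: bounded_linear L
    by fact
  define V where "V = {x. L x = 0}"
  have V: "subspace V" "closed V"
    unfolding V_def
    by (simp add: subspace_def L.zero L.add L.scaleR)
      (intro closed_Collect_eq continuous_intros linear_continuous_on L)
  define z where "z = u - orth_proj V u"
  have Lz: "L z \<noteq> 0"
    using orth_proj_in[OF V, of u] u by (simp add: z_def L.diff V_def)
  then have z: "z \<bullet> z \<noteq> 0"
    using L.zero by auto
  have "L x = x \<bullet> ((L z / (z \<bullet> z)) *\<^sub>R z)" for x
  proof -
    have "x - (L x / L z) *\<^sub>R z \<in> V"
      using Lz by (simp add: V_def L.diff L.scaleR)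
    then have "(x - (L x / L z) *\<^sub>R z) \<bullet> z = 0"
      using orth_proj_compl[OF V, of u] by (auto simp: z_def orthogonal_comp_def orthogonal_def)
    then have "x \<bullet> z = (L x / L z) * (z \<bullet> z)"
      by (simp add: inner_diff_left)
    then show ?thesis
      using Lz z by simp
  qed
  then show ?thesis
    by blast
qed

text \<open>\<open>grad\<close> is a definite description: the Riesz vector of the derivative gives
  existence, and uniqueness of derivatives gives uniqueness.\<close>

lemma GDERIV_grad:
  fixes \<phi> :: "'a::{real_inner, complete_space} \<Rightarrow> real"
  assumes "\<phi> differentiable (at u)"
  shows "GDERIV \<phi> u :> grad \<phi> u"
proof -
  obtain L where L: "(\<phi> has_derivative L) (at u)"
    using assms by (auto simp: differentiable_def)
  obtain w where w: "\<And>x. L x = x \<bullet> w"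
    using riesz_representation[OF has_derivative_bounded_linear[OF L]] by blast
  have "GDERIV \<phi> u :> w"
    using L w by (metis ext gderiv_def)
  moreover have "D = w" if "GDERIV \<phi> u :> D" for D
    using has_derivative_unique[OF that[unfolded gderiv_def] \<open>GDERIV \<phi> u :> w\<close>[unfolded gderiv_def]]
    by (metis vector_eq_ldot)
  ultimately show ?thesis
    unfolding grad_def by (rule theI)
qed

lemma fderiv_grad:
  fixes \<phi> :: "'a::{real_inner, complete_space} \<Rightarrow> real"
  assumes "\<phi> differentiable (at u)"
  shows "blinfun_apply (fderiv \<phi> u) h = h \<bullet> grad \<phi> u"
proof -
  have d: "(\<phi> has_derivative frechet_derivative \<phi> (at u)) (at u)"
    using assms frechet_derivative_works by blast
  have "frechet_derivative \<phi> (at u) = (\<lambda>h. h \<bullet> grad \<phi> u)"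
    using GDERIV_grad[OF assms] frechet_derivative_at by (metis gderiv_def)
  then show ?thesis
    using has_derivative_bounded_linear[OF d] by (simp add: fderiv_def bounded_linear_Blinfun_apply)
qed

text \<open>The descent argument works with gradients, \<open>palais_smale\<close> with the operator
  norm of the derivative; this turns a small gradient into a small derivative.\<close>

lemma norm_fderiv_le_grad:
  fixes \<phi> :: "'a::{real_inner, complete_space} \<Rightarrow> real"
  assumes "\<phi> differentiable (at u)"
  shows "norm (fderiv \<phi> u) \<le> norm (grad \<phi> u)"
  using Cauchy_Schwarz_ineq2[of _ "grad \<phi> u"]
  by (intro norm_blinfun_bound) (auto simp: fderiv_grad[OF assms] mult.commute)

section \<open>Weak convergence\<close>

lemma weak_lim_diff:
  "weak_lim u l \<Longrightarrow> weak_lim v m \<Longrightarrow> weak_lim (\<lambda>n. u n - v n) (l - m)"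
  by (auto simp: weak_lim_def inner_diff_left intro!: tendsto_diff)

lemma weak_lim_tendsto: "u \<longlonglongrightarrow> l \<Longrightarrow> weak_lim u l"
  by (auto simp: weak_lim_def intro!: tendsto_intros)

text \<open>Convergence passes from \<open>S\<close> to its span by linearity, to \<open>H\<close>
  by density and the bound \<open>C\<close>, and to every \<open>v\<close> because
  \<open>u n\<close> and \<open>l\<close> see only its projection to \<open>H\<close>.\<close>

lemma weak_lim_of_total:
  fixes u :: "nat \<Rightarrow> 'a::{real_inner, complete_space}"
  assumes H: "subspace H" "closed H" "H \<subseteq> closure (span S)"
    and u: "\<And>n. u n \<in> H" "l \<in> H" "\<And>n. norm (u n) \<le> C"
    and lim: "\<And>v. v \<in> S \<Longrightarrow> (\<lambda>n. u n \<bullet> v) \<longlonglongrightarrow> l \<bullet> v"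
  shows "weak_lim u l"
  unfolding weak_lim_def
proof
  have span: "(\<lambda>n. u n \<bullet> v) \<longlonglongrightarrow> l \<bullet> v" if "v \<in> span S" for v
    using that
    by (induction rule: span_induct_alt) (auto simp: inner_add_right intro!: tendsto_intros lim)
  have H: "(\<lambda>n. u n \<bullet> v) \<longlonglongrightarrow> l \<bullet> v" if "v \<in> H" for v
  proof (rule LIMSEQ_I)
    fix \<epsilon> :: real assume "\<epsilon> > 0"
    \<comment> \<open>The summand 1 keeps this bound on \<open>norm (u n - l)\<close> positive, so
      that \<open>\<epsilon> / (2 * C')\<close> is a positive tolerance.\<close>
    define C' where "C' = \<bar>C\<bar> + norm l + 1"
    have C': "C' > 0" "norm (u n - l) \<le> C'" for n
      using u(3)[of n] norm_triangle_ineq4[of "u n" l] by (auto simp: C'_def add_nonneg_pos)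
    have "v \<in> closure (span S)"
      using that assms(3) by blast
    then obtain w where w: "w \<in> span S" "dist w v < \<epsilon> / (2 * C')"
      using \<open>\<epsilon> > 0\<close> C'(1) unfolding closure_approachable by (meson divide_pos_pos mult_pos_pos zero_less_numeral)
    obtain N where N: "\<And>n. n \<ge> N \<Longrightarrow> norm (u n \<bullet> w - l \<bullet> w) < \<epsilon> / 2"
      using LIMSEQ_D[OF span[OF w(1)], of "\<epsilon> / 2"] \<open>\<epsilon> > 0\<close> by auto
    have "norm (u n \<bullet> v - l \<bullet> v) < \<epsilon>" if "n \<ge> N" for n
    proof -
      have "\<bar>(u n - l) \<bullet> (v - w)\<bar> \<le> C' * norm (v - w)"
        using Cauchy_Schwarz_ineq2[of "u n - l" "v - w"] C'(2)[of n]
        by (meson mult_right_mono norm_ge_zero order_trans)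
      also have "\<dots> < C' * (\<epsilon> / (2 * C'))"
        using w(2) C'(1) by (intro mult_strict_left_mono) (auto simp: dist_norm norm_minus_commute)
      finally have "\<bar>(u n - l) \<bullet> (v - w)\<bar> < \<epsilon> / 2"
        using C'(1) by simp
      moreover have "u n \<bullet> v - l \<bullet> v = (u n - l) \<bullet> (v - w) + (u n \<bullet> w - l \<bullet> w)"
        by (simp add: inner_simps)
      ultimately show ?thesis
        using N[OF that] unfolding real_norm_def by linarith
    qed
    then show "\<exists>N. \<forall>n\<ge>N. norm (u n \<bullet> v - l \<bullet> v) < \<epsilon>"
      by blast
  qed
  show "(\<lambda>n. u n \<bullet> v) \<longlonglongrightarrow> l \<bullet> v" for v
    using H[OF orth_proj_in[OF assms(1,2), of v]] inner_orth_proj[OF assms(1,2) u(1), of v]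
      inner_orth_proj[OF assms(1,2) u(2), of v] by (simp add: inner_commute)
qed

text \<open>The Radon-Riesz property: in the expansion of the squared norm of
  \<open>u n - l\<close>, weak convergence controls the mixed term and the hypothesis the
  rest.\<close>

lemma weak_lim_norm_tendsto:
  fixes u :: "nat \<Rightarrow> 'a::real_inner"
  assumes "weak_lim u l" "(\<lambda>n. (norm (u n))\<^sup>2) \<longlonglongrightarrow> (norm l)\<^sup>2"
  shows "u \<longlonglongrightarrow> l"
proof -
  have "(\<lambda>n. (norm (u n))\<^sup>2 - 2 * (u n \<bullet> l) + (norm l)\<^sup>2) \<longlonglongrightarrow> (norm l)\<^sup>2 - 2 * (l \<bullet> l) + (norm l)\<^sup>2"
    using assms(1) unfolding weak_lim_def by (intro tendsto_add tendsto_diff tendsto_mult tendsto_const assms(2)) blast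
  moreover have "(norm (u n))\<^sup>2 - 2 * (u n \<bullet> l) + (norm l)\<^sup>2 = (norm (u n - l))\<^sup>2" for n
    by (simp add: power2_norm_eq_inner inner_simps inner_commute)
  ultimately have "(\<lambda>n. (norm (u n - l))\<^sup>2) \<longlonglongrightarrow> 0"
    by (simp add: power2_norm_eq_inner)
  then have "(\<lambda>n. sqrt ((norm (u n - l))\<^sup>2)) \<longlonglongrightarrow> sqrt 0"
    by (rule tendsto_real_sqrt)
  then show ?thesis
    by (simp add: tendsto_norm_zero_iff LIM_zero_iff)
qed

lemma weak_lim_inner_tendsto:
  fixes u v :: "nat \<Rightarrow> 'a::real_inner"
  assumes "weak_lim u l" "v \<longlonglongrightarrow> m" "\<And>n. norm (u n) \<le> C"
  shows "(\<lambda>n. u n \<bullet> v n) \<longlonglongrightarrow> l \<bullet> m"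
proof -
  have "(\<lambda>n. u n \<bullet> (v n - m)) \<longlonglongrightarrow> 0"
  proof (rule Lim_null_comparison)
    have "norm (u n \<bullet> (v n - m)) \<le> C * norm (v n - m)" for n
      using Cauchy_Schwarz_ineq2[of "u n" "v n - m"] assms(3)[of n]
      by (metis mult_right_mono norm_ge_zero order_trans real_norm_def)
    then show "\<forall>\<^sub>F n in sequentially. norm (u n \<bullet> (v n - m)) \<le> C * norm (v n - m)"
      by simp
    show "(\<lambda>n. C * norm (v n - m)) \<longlonglongrightarrow> 0"
      using assms(2) by (intro tendsto_mult_right_zero tendsto_norm_zero) (simp add: LIM_zero_iff)
  qed
  moreover have "(\<lambda>n. u n \<bullet> m) \<longlonglongrightarrow> l \<bullet> m"
    using assms(1) by (simp add: weak_lim_def)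
  ultimately have "(\<lambda>n. u n \<bullet> (v n - m) + u n \<bullet> m) \<longlonglongrightarrow> 0 + l \<bullet> m"
    by (rule tendsto_add)
  then show ?thesis
    by (simp add: inner_simps)
qed

section \<open>Coordinates with respect to an orthonormal sequence\<close>

definition coords :: "nat set \<Rightarrow> (nat \<Rightarrow> 'a::real_inner) \<Rightarrow> 'a \<Rightarrow> nat \<Rightarrow> real" where
  "coords I b u = (\<lambda>j. if j \<in> I then u \<bullet> b j else 0)"

definition series :: "(nat \<Rightarrow> 'a::real_normed_vector) \<Rightarrow> (nat \<Rightarrow> real) \<Rightarrow> 'a" where
  "series b x = (\<Sum>j. x j *\<^sub>R b j)"

text \<open>Coordinate sequences of the closed ball, with the product topology in place of the weak
  one. Bounding all partial sums, rather than an infinite sum, makes the set visibly closed under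
  coordinatewise limits.\<close>

definition coord_ball :: "nat set \<Rightarrow> real \<Rightarrow> (nat \<Rightarrow> real) set" where
  "coord_ball I R = {x. (\<forall>j. j \<notin> I \<longrightarrow> x j = 0) \<and> (\<forall>n. (\<Sum>j<n. (x j)\<^sup>2) \<le> R\<^sup>2)}"

text \<open>A closed subset of a product of copies of
  \<open>{-\<bar>R\<bar>..\<bar>R\<bar>}\<close>, which is compact by Tychonoff.\<close>

lemma compact_coord_ball: "compact (coord_ball I R)"
proof -
  have cont: "continuous_on UNIV (\<lambda>x::nat \<Rightarrow> real. x j)" for j
    by simp
  have "closed ({x. \<forall>j. j \<notin> I \<longrightarrow> x j = 0} \<inter> {x::nat \<Rightarrow> real. \<forall>n. (\<Sum>j<n. (x j)\<^sup>2) \<le> R\<^sup>2})"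
    by (intro closed_Int closed_Collect_all closed_Collect_imp closed_Collect_le closed_Collect_eq
        open_Collect_const continuous_intros continuous_on_sum continuous_on_power cont)
  then have "closed (coord_ball I R)"
    by (simp add: coord_ball_def Collect_conj_eq)
  moreover have "compact (PiE UNIV (\<lambda>_::nat. {-\<bar>R\<bar>..\<bar>R\<bar>}))"
    using compactin_PiE[of "\<lambda>_. euclidean" UNIV "\<lambda>_::nat. {-\<bar>R\<bar>..\<bar>R\<bar>}"]
    by (simp add: euclidean_product_topology)
  moreover have "coord_ball I R \<subseteq> PiE UNIV (\<lambda>_::nat. {-\<bar>R\<bar>..\<bar>R\<bar>})"
  proof
    fix x assume x: "x \<in> coord_ball I R"
    have "\<bar>x j\<bar> \<le> \<bar>R\<bar>" for j
    proof -
      have "(x j)\<^sup>2 \<le> (\<Sum>i<Suc j. (x i)\<^sup>2)"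
        by (simp add: sum_nonneg)
      also have "\<dots> \<le> R\<^sup>2"
        using x by (simp only: coord_ball_def mem_Collect_eq)
      finally show ?thesis
        by (simp add: abs_le_square_iff)
    qed
    then show "x \<in> PiE UNIV (\<lambda>_::nat. {-\<bar>R\<bar>..\<bar>R\<bar>})"
      by (auto simp: abs_le_iff) (smt (verit))+
  qed
  ultimately show ?thesis
    using compact_Int_closed by (metis inf.absorb_iff2)
qed

lemma coord_ball_uminus: "x \<in> coord_ball I R \<Longrightarrow> (\<lambda>j. - x j) \<in> coord_ball I R"
  by (simp add: coord_ball_def)

locale orthonormal_family =
  fixes H :: "'a::{real_inner, complete_space} set" and I :: "nat set" and b :: "nat \<Rightarrow> 'a"
  assumes total: "total_orthonormal H I b"
begin

lemma inner_b: "i \<in> I \<Longrightarrow> j \<in> I \<Longrightarrow> b i \<bullet> b j = (if i = j then 1 else 0)"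
  using total by (simp add: total_orthonormal_def)

lemma norm_b: "j \<in> I \<Longrightarrow> norm (b j) = 1"
  by (simp add: norm_eq_sqrt_inner inner_b)

lemma H_eq: "H = closure (span (b ` I))"
  using total by (simp add: total_orthonormal_def)

lemma subspace_H: "subspace H" and closed_H: "closed H"
  by (simp_all add: H_eq subspace_closure)

lemma span_subset_H: "span (b ` I) \<subseteq> H"
  by (simp add: H_eq closure_subset)

lemma b_in_H: "j \<in> I \<Longrightarrow> b j \<in> H"
  using span_subset_H span_base by blast

lemma H_eqI_zero:
  assumes "w \<in> H" "\<And>j. j \<in> I \<Longrightarrow> w \<bullet> b j = 0"
  shows "w = 0"
proof -
  have "span (b ` I) \<subseteq> {v. w \<bullet> v = 0}"
    using assms(2) by (intro span_minimal) (auto simp: subspace_def inner_simps)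
  then have "closure (span (b ` I)) \<subseteq> {v. w \<bullet> v = 0}"
    by (intro closure_minimal closed_Collect_eq continuous_intros)
  then show ?thesis
    using assms(1) by (auto simp: H_eq)
qed

lemma norm_partial_sum:
  assumes "finite A" "\<And>j. j \<notin> I \<Longrightarrow> x j = 0"
  shows "(norm (\<Sum>j\<in>A. x j *\<^sub>R b j))\<^sup>2 = (\<Sum>j\<in>A. (x j)\<^sup>2)"
proof -
  have "pairwise (\<lambda>i j. orthogonal (x i *\<^sub>R b i) (x j *\<^sub>R b j)) A"
    unfolding pairwise_def orthogonal_def
    by (metis assms(2) inner_b inner_scaleR_left inner_scaleR_right inner_zero_left inner_zero_right
        mult_zero_right scale_eq_0_iff)
  then have "(norm (\<Sum>j\<in>A. x j *\<^sub>R b j))\<^sup>2 = (\<Sum>j\<in>A. (norm (x j *\<^sub>R b j))\<^sup>2)"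
    using assms(1) by (rule norm_sum_Pythagorean[rotated])
  moreover have "(norm (x j *\<^sub>R b j))\<^sup>2 = (x j)\<^sup>2" for j
    using assms(2)[of j] norm_b[of j] by (cases "j \<in> I") (auto simp: power_mult_distrib)
  ultimately show ?thesis
    by simp
qed

text \<open>By orthonormality the squared norm of a block of the series is a block of the series of
  squares, whose partial sums are bounded by definition of \<open>coord_ball\<close>.\<close>

lemma summable_series:
  assumes "x \<in> coord_ball I R"
  shows "summable (\<lambda>j. x j *\<^sub>R b j)"
  unfolding summable_iff_convergent
proof (intro Cauchy_convergent CauchyI')
  fix \<epsilon> :: real assume \<epsilon>: "\<epsilon> > 0"
  have x: "\<And>j. j \<notin> I \<Longrightarrow> x j = 0" "\<And>n. (\<Sum>j<n. (x j)\<^sup>2) \<le> R\<^sup>2"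
    using assms by (auto simp: coord_ball_def)
  have "summable (\<lambda>j. (x j)\<^sup>2)"
    using x(2) by (intro summableI_nonneg_bounded) auto
  then obtain N where N: "\<And>m n. m \<ge> N \<Longrightarrow> norm (\<Sum>j\<in>{m..<n}. (x j)\<^sup>2) < \<epsilon>\<^sup>2"
    using \<epsilon> unfolding summable_Cauchy by (meson zero_less_power)
  have "norm (\<Sum>j\<in>{m..<n}. x j *\<^sub>R b j) < \<epsilon>" if "m \<ge> N" for m n
  proof -
    have "(norm (\<Sum>j\<in>{m..<n}. x j *\<^sub>R b j))\<^sup>2 < \<epsilon>\<^sup>2"
      using N[OF that, of n] norm_partial_sum[of "{m..<n}" x] x(1) by auto
    then show ?thesis
      using \<epsilon> by (simp add: power_less_imp_less_base)
  qed
  then have "dist (\<Sum>j<m. x j *\<^sub>R b j) (\<Sum>j<n. x j *\<^sub>R b j) < \<epsilon>" if "m \<ge> N" "n > m" for m n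
    using that sum_diff_nat_ivl[of 0 m n "\<lambda>j. x j *\<^sub>R b j"]
    by (subst dist_commute) (simp add: atLeast0LessThan dist_norm)
  then show "\<exists>N. \<forall>m\<ge>N. \<forall>n>m. dist (\<Sum>j<m. x j *\<^sub>R b j) (\<Sum>j<n. x j *\<^sub>R b j) < \<epsilon>"
    by blast
qed

lemma series_LIMSEQ:
  assumes "x \<in> coord_ball I R"
  shows "(\<lambda>n. \<Sum>j<n. x j *\<^sub>R b j) \<longlonglongrightarrow> series b x"
  unfolding series_def using summable_series[OF assms] by (rule summable_LIMSEQ)

lemma inner_series:
  assumes "x \<in> coord_ball I R" "i \<in> I"
  shows "series b x \<bullet> b i = x i"
proof -
  have "(\<lambda>n. (\<Sum>j<n. x j *\<^sub>R b j) \<bullet> b i) \<longlonglongrightarrow> series b x \<bullet> b i"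
    by (intro tendsto_intros series_LIMSEQ[OF assms(1)])
  moreover have "\<forall>\<^sub>F n in sequentially. (\<Sum>j<n. x j *\<^sub>R b j) \<bullet> b i = x i"
    using eventually_gt_at_top[of i]
  proof eventually_elim
    case (elim n)
    have "(\<Sum>j<n. x j *\<^sub>R b j) \<bullet> b i = (\<Sum>j<n. if j = i then x i else 0)"
      unfolding inner_sum_left
    proof (intro sum.cong refl)
      fix j
      show "x j *\<^sub>R b j \<bullet> b i = (if j = i then x i else 0)"
        using assms inner_b[of j i] by (cases "j \<in> I") (auto simp: coord_ball_def)
    qed
    then show ?case
      using elim by simp
  qed
  ultimately show ?thesis
    by (rule LIMSEQ_unique[OF _ tendsto_eventually])
qed

lemma norm_series_le:
  assumes "x \<in> coord_ball I R" "R \<ge> 0"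
  shows "norm (series b x) \<le> R"
proof -
  have "norm (\<Sum>j<n. x j *\<^sub>R b j) \<le> R" for n
  proof -
    have "(norm (\<Sum>j<n. x j *\<^sub>R b j))\<^sup>2 \<le> R\<^sup>2"
      using norm_partial_sum[of "{..<n}" x] assms(1) by (auto simp: coord_ball_def)
    then show ?thesis
      using assms(2) by (rule power2_le_imp_le)
  qed
  then show ?thesis
    using Lim_bounded[OF tendsto_norm[OF series_LIMSEQ[OF assms(1)]]] by blast
qed

lemma series_in_closed_subspace:
  assumes "x \<in> coord_ball I R" "subspace V" "closed V" "\<And>j. x j *\<^sub>R b j \<in> V"
  shows "series b x \<in> V"
proof (rule closed_sequentially[OF assms(3) _ series_LIMSEQ[OF assms(1)]])
  show "(\<Sum>j<n. x j *\<^sub>R b j) \<in> V" for n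
    using assms by (intro subspace_sum) auto
qed

lemma series_in_H: "x \<in> coord_ball I R \<Longrightarrow> series b x \<in> H"
proof (rule series_in_closed_subspace[OF _ subspace_H closed_H])
  fix j assume "x \<in> coord_ball I R"
  then show "x j *\<^sub>R b j \<in> H"
    using subspace_scale[OF subspace_H b_in_H[of j]] subspace_0[OF subspace_H]
    by (cases "j \<in> I") (auto simp: coord_ball_def)
qed

text \<open>Bessel's inequality, from nonnegativity of the squared norm of \<open>u - s\<close> for
  the partial expansion \<open>s\<close>.\<close>

lemma coords_in_coord_ball:
  assumes "norm u \<le> R"
  shows "coords I b u \<in> coord_ball I R"
proof -
  have "(\<Sum>j<n. (coords I b u j)\<^sup>2) \<le> R\<^sup>2" for n
  proof -
    define s where "s = (\<Sum>j<n. coords I b u j *\<^sub>R b j)"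
    have us: "u \<bullet> s = (\<Sum>j<n. (coords I b u j)\<^sup>2)"
      unfolding s_def inner_sum_right
      by (intro sum.cong refl) (simp add: coords_def power2_eq_square)
    have ss: "s \<bullet> s = (\<Sum>j<n. (coords I b u j)\<^sup>2)"
      using norm_partial_sum[of "{..<n}" "coords I b u"]
      by (simp add: s_def coords_def power2_norm_eq_inner)
    have "0 \<le> (u - s) \<bullet> (u - s)"
      by simp
    also have "\<dots> = u \<bullet> u - u \<bullet> s"
      using us ss by (simp add: inner_simps inner_commute)
    finally have "u \<bullet> s \<le> (norm u)\<^sup>2"
      by (simp add: power2_norm_eq_inner)
    also have "\<dots> \<le> R\<^sup>2"
      using assms by (simp add: power_mono)
    finally show ?thesis
      by (simp add: us)
  qed
  then show ?thesis
    by (simp add: coord_ball_def coords_def)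
qed

lemma series_coords:
  assumes "u \<in> H"
  shows "series b (coords I b u) = u"
proof -
  have c: "coords I b u \<in> coord_ball I (norm u)"
    by (rule coords_in_coord_ball) simp
  have "series b (coords I b u) - u = 0"
  proof (rule H_eqI_zero)
    show "series b (coords I b u) - u \<in> H"
      using assms c by (intro subspace_diff subspace_H series_in_H)
    show "(series b (coords I b u) - u) \<bullet> b j = 0" if "j \<in> I" for j
      using inner_series[OF c that] that by (simp add: inner_diff_left coords_def)
  qed
  then show ?thesis
    by simp
qed

lemma continuous_on_coords: "continuous_on S (coords I b)"
proof (rule continuous_on_coordinatewise_then_product)
  show "continuous_on S (\<lambda>u. coords I b u j)" for j
    by (cases "j \<in> I") (auto simp: coords_def intro!: continuous_intros)
qed

lemma coords_uminus: "coords I b (- u) = (\<lambda>j. - coords I b u j)"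
  by (auto simp: coords_def)

lemma series_uminus:
  assumes "x \<in> coord_ball I R"
  shows "series b (\<lambda>j. - x j) = - series b x"
  using suminf_minus[OF summable_series[OF assms]] by (simp add: series_def)

text \<open>The link between the two topologies: compactness is obtained for coordinate sequences,
  while the gradient is continuous for weak convergence of vectors.\<close>

lemma series_weak_lim:
  assumes "\<And>n. x n \<in> coord_ball I R" "y \<in> coord_ball I R" "R \<ge> 0" "x \<longlonglongrightarrow> y"
  shows "weak_lim (\<lambda>n. series b (x n)) (series b y)"
proof (rule weak_lim_of_total[OF subspace_H closed_H, where S="b ` I" and C=R])
  fix v assume "v \<in> b ` I"
  then obtain j where j: "j \<in> I" "v = b j"
    by blast
  have "continuous_on UNIV (\<lambda>f::nat \<Rightarrow> real. f j)"
    by simp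
  then have "isCont (\<lambda>f::nat \<Rightarrow> real. f j) y"
    unfolding continuous_on_eq_continuous_at[OF open_UNIV] by blast
  then have "(\<lambda>n. x n j) \<longlonglongrightarrow> y j"
    using assms(4) by (rule isCont_tendsto_compose)
  then show "(\<lambda>n. series b (x n) \<bullet> v) \<longlonglongrightarrow> series b y \<bullet> v"
    using inner_series[OF assms(1) j(1)] inner_series[OF assms(2) j(1)] by (simp add: j(2))
qed (use assms H_eq series_in_H norm_series_le in auto)

text \<open>Provides the finite-dimensional spaces of the Galerkin argument. An index set that is an
  initial segment stays one after truncation, as \<open>total_orthonormal\<close> demands.\<close>

lemma total_orthonormal_initial:
  "\<exists>m. {..<n} \<inter> I = {..<m} \<and> total_orthonormal (span (b ` ({..<n} \<inter> I))) {..<m} b"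
proof -
  have "\<exists>m. {..<n} \<inter> I = {..<m}"
  proof -
    consider "I = UNIV" | k where "I = {..<k}"
      using total unfolding total_orthonormal_def by blast
    then show ?thesis
    proof cases
      case 1
      then show ?thesis by (intro exI[where x=n]) simp
    next
      case 2
      then show ?thesis by (intro exI[where x="min n k"]) auto
    qed
  qed
  then obtain m where m: "{..<n} \<inter> I = {..<m}"
    by blast
  then have sub: "{..<m} \<subseteq> I"
    by blast
  define E where "E = span (b ` {..<m})"
  \<comment> \<open>The expansion formula describes \<open>E\<close> as the solution set of a
    continuous equation, hence as a closed set.\<close>
  have E_iff: "u \<in> E \<longleftrightarrow> u = (\<Sum>j<m. (u \<bullet> b j) *\<^sub>R b j)" for u
  proof
    assume "u \<in> E"
    then show "u = (\<Sum>j<m. (u \<bullet> b j) *\<^sub>R b j)"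
      unfolding E_def
    proof (induction rule: span_induct_alt)
      case (step c v w)
      then obtain i where i: "i < m" "v = b i"
        by blast
      have "(v \<bullet> b j) = (if j = i then 1 else 0)" if "j < m" for j
        using inner_b[of i j] subsetD[OF sub, of i] subsetD[OF sub, of j] i that by auto
      then have "(\<Sum>j<m. (v \<bullet> b j) *\<^sub>R b j) = (\<Sum>j<m. if j = i then b i else 0)"
        by (intro sum.cong) auto
      then have "v = (\<Sum>j<m. (v \<bullet> b j) *\<^sub>R b j)"
        using i by simp
      then have "c *\<^sub>R v = (\<Sum>j<m. ((c *\<^sub>R v) \<bullet> b j) *\<^sub>R b j)"
        by (metis (mono_tags, lifting) inner_scaleR_left scaleR_scaleR scaleR_sum_right sum.cong)
      then show ?case
        using step.IH unfolding inner_add_left scaleR_add_left sum.distrib by metis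
    qed simp
  next
    assume "u = (\<Sum>j<m. (u \<bullet> b j) *\<^sub>R b j)"
    then show "u \<in> E"
      unfolding E_def by (metis (no_types, lifting) imageI span_base span_scale span_sum)
  qed
  have "E = {u. u = (\<Sum>j<m. (u \<bullet> b j) *\<^sub>R b j)}"
    using E_iff by blast
  moreover have "closed {u. u = (\<Sum>j<m. (u \<bullet> b j) *\<^sub>R b j)}"
    by (intro closed_Collect_eq continuous_intros)
  ultimately have "closed E"
    by simp
  then show ?thesis
    using m inner_b subsetD[OF sub] unfolding total_orthonormal_def E_def
    by (intro exI[where x=m]) (auto simp del: lessThan_iff)
qed

end

section \<open>The topologies sigma and tau\<close>

lemma weighted_norm_finite:
  "weighted_norm {..<m} b u = (\<Sum>j<m. (1 / 2) ^ (j + 1) * \<bar>u \<bullet> b j\<bar>)"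
  by (simp add: weighted_norm_def)

lemma weighted_norm_nonneg: "weighted_norm I b u \<ge> 0"
  unfolding weighted_norm_def by (intro infsum_nonneg) auto

lemma weighted_norm_minus_commute: "weighted_norm I b (u - v) = weighted_norm I b (v - u)"
  unfolding weighted_norm_def inner_diff_left by (simp add: abs_minus_commute)

text \<open>In finite dimension the weighted norm is equivalent to the Hilbert norm, with constants
  \<open>2 ^ m\<close> and \<open>m\<close>. This reduces sigma-admissibility there to ordinary
  continuity.\<close>

lemma sigma_topology_finite:
  fixes E :: "'a::{real_inner, complete_space} set"
  assumes "total_orthonormal E {..<m} b"
  shows "sigma_topology E {..<m} b = top_of_set E"
proof -
  interpret orthonormal_family E "{..<m}" b
    using assms by unfold_locales
  let ?w = "weighted_norm {..<m} b"
  have upper: "norm u \<le> 2 ^ m * ?w u" if "u \<in> E" for u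
  proof -
    have c: "coords {..<m} b u \<in> coord_ball {..<m} (norm u)"
      by (rule coords_in_coord_ball) simp
    have "u = (\<Sum>j. coords {..<m} b u j *\<^sub>R b j)"
      using series_coords[OF that] by (simp add: series_def)
    also have "\<dots> = (\<Sum>j<m. coords {..<m} b u j *\<^sub>R b j)"
      by (rule suminf_finite) (auto simp: coords_def)
    finally have "norm u \<le> (\<Sum>j<m. norm (coords {..<m} b u j *\<^sub>R b j))"
      using norm_sum[of "\<lambda>j. coords {..<m} b u j *\<^sub>R b j" "{..<m}"] by simp
    also have "\<dots> \<le> (\<Sum>j<m. 2 ^ m * ((1 / 2) ^ (j + 1) * \<bar>u \<bullet> b j\<bar>))"
    proof (intro sum_mono)
      fix j assume j: "j \<in> {..<m}"
      \<comment> \<open>The factor \<open>2 ^ m\<close> compensates every weight with index below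
        \<open>m\<close>.\<close>
      have "(2::real) ^ m = 2 ^ (j + 1) * 2 ^ (m - (j + 1))"
        using j by (subst power_add[symmetric]) simp
      then have "(1::real) \<le> 2 ^ m * (1 / 2) ^ (j + 1)"
        by (simp add: power_divide field_simps)
      then have "1 * \<bar>u \<bullet> b j\<bar> \<le> (2 ^ m * (1 / 2) ^ (j + 1)) * \<bar>u \<bullet> b j\<bar>"
        by (intro mult_right_mono) auto
      then show "norm (coords {..<m} b u j *\<^sub>R b j) \<le> 2 ^ m * ((1 / 2) ^ (j + 1) * \<bar>u \<bullet> b j\<bar>)"
        using j norm_b by (simp add: coords_def mult.assoc)
    qed
    also have "\<dots> = 2 ^ m * ?w u"
      by (simp add: weighted_norm_finite sum_distrib_left)
    finally show ?thesis .
  qed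
  have lower: "?w u \<le> real m * norm u" for u
  proof -
    have "?w u \<le> (\<Sum>j<m. norm u)"
      unfolding weighted_norm_finite
    proof (intro sum_mono)
      fix j assume j: "j \<in> {..<m}"
      have "(1 / 2) ^ (j + 1) * \<bar>u \<bullet> b j\<bar> \<le> 1 * (norm u * norm (b j))"
        by (intro mult_mono Cauchy_Schwarz_ineq2 power_le_one) auto
      then show "(1 / 2) ^ (j + 1) * \<bar>u \<bullet> b j\<bar> \<le> norm u"
        using norm_b[OF j] by simp
    qed
    then show ?thesis
      by simp
  qed
  interpret M: Metric_space E "\<lambda>u v. ?w (u - v)"
  proof
    show "?w (u - v) = 0 \<longleftrightarrow> u = v" if "u \<in> E" "v \<in> E" for u v
    proof
      assume "?w (u - v) = 0"
      then show "u = v"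
        using upper[of "u - v"] that subspace_diff[OF subspace_H] by auto
    qed (simp add: weighted_norm_finite)
    show "?w (u - w) \<le> ?w (u - v) + ?w (v - w)" for u v w
      unfolding weighted_norm_finite sum.distrib[symmetric] distrib_left[symmetric]
      by (intro sum_mono mult_left_mono) (auto simp: inner_diff_left)
  qed (auto simp: weighted_norm_nonneg weighted_norm_minus_commute)
  show ?thesis
    unfolding topology_eq sigma_topology_def norm_topology_def M.openin_mtopology openin_euclidean_subtopology_iff
  proof (intro allI conj_cong refl iffI impI ballI)
    fix S x assume "S \<subseteq> E" and *: "\<forall>x. x \<in> S \<longrightarrow> (\<exists>r>0. M.mball x r \<subseteq> S)" and x: "x \<in> S"
    then obtain r where r: "r > 0" "M.mball x r \<subseteq> S"
      by blast
    \<comment> \<open>Dividing by \<open>m + 1\<close> instead of \<open>m\<close> covers the zero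
      space, where \<open>m = 0\<close>.\<close>
    have "y \<in> S" if "y \<in> E" "dist y x < r / (real m + 1)" for y
    proof -
      have "?w (x - y) \<le> real m * norm (x - y)"
        by (rule lower)
      also have "\<dots> \<le> (real m + 1) * norm (x - y)"
        by (intro mult_right_mono) auto
      also have "\<dots> < (real m + 1) * (r / (real m + 1))"
        using that(2) by (intro mult_strict_left_mono) (auto simp: dist_norm norm_minus_commute)
      finally have "?w (x - y) < r"
        by simp
      then show ?thesis
        using r(2) x \<open>S \<subseteq> E\<close> that(1) by (auto simp: M.mball_def)
    qed
    then show "\<exists>e>0. \<forall>x'\<in>E. dist x' x < e \<longrightarrow> x' \<in> S"
      using r(1) by (intro exI[where x="r / (real m + 1)"]) auto
  next
    fix S x assume "S \<subseteq> E" and *: "\<forall>x\<in>S. \<exists>e>0. \<forall>x'\<in>E. dist x' x < e \<longrightarrow> x' \<in> S" and x: "x \<in> S"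
    then obtain \<epsilon> where \<epsilon>: "\<epsilon> > 0" "\<And>y. y \<in> E \<Longrightarrow> dist y x < \<epsilon> \<Longrightarrow> y \<in> S"
      by blast
    have "y \<in> S" if "y \<in> M.mball x (\<epsilon> / 2 ^ m)" for y
    proof -
      have y: "y \<in> E" "?w (x - y) < \<epsilon> / 2 ^ m"
        using that by (auto simp: M.mball_def)
      have "norm (x - y) \<le> 2 ^ m * ?w (x - y)"
        using x \<open>S \<subseteq> E\<close> y(1) by (intro upper subspace_diff subspace_H) auto
      also have "\<dots> < 2 ^ m * (\<epsilon> / 2 ^ m)"
        using y(2) by (intro mult_strict_left_mono) auto
      finally show ?thesis
        using \<epsilon>(2)[OF y(1)] by (simp add: dist_norm norm_minus_commute)
    qed
    then show "\<exists>r>0. M.mball x r \<subseteq> S"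
      using \<epsilon>(1) by (intro exI[where x="\<epsilon> / 2 ^ m"]) auto
  qed
qed

text \<open>Rewrites the unordered sum as an ordinary series with zero terms off \<open>I\<close>,
  to which termwise comparison and dominated convergence apply; the geometric weights make it
  summable.\<close>

lemma weighted_norm_sums:
  assumes "\<And>j. j \<in> I \<Longrightarrow> \<bar>u \<bullet> b j\<bar> \<le> C"
  shows "(\<lambda>j. if j \<in> I then (1 / 2) ^ (j + 1) * \<bar>u \<bullet> b j\<bar> else 0) sums weighted_norm I b u"
proof -
  let ?f = "\<lambda>j. if j \<in> I then (1 / 2) ^ (j + 1) * \<bar>u \<bullet> b j\<bar> else 0"
  have "summable ?f"
  proof (rule summable_comparison_test)
    show "summable (\<lambda>j. (1 / 2) ^ (j + 1) * \<bar>C\<bar>)"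
      by (intro summable_mult2 summable_ignore_initial_segment summable_geometric) auto
    show "\<exists>N. \<forall>n\<ge>N. norm (?f n) \<le> (1 / 2) ^ (n + 1) * \<bar>C\<bar>"
      using assms by (auto simp: intro!: mult_left_mono order_trans[OF _ abs_ge_self])
  qed
  moreover have "norm (?f j) = ?f j" for j
    by simp
  ultimately have "(?f has_sum suminf ?f) UNIV"
    by (intro norm_summable_imp_has_sum summable_sums) simp_all
  then have "infsum ?f UNIV = suminf ?f"
    by (rule infsumI)
  moreover have "infsum ?f UNIV = weighted_norm I b u"
    unfolding weighted_norm_def by (rule infsum_cong_neutral) auto
  ultimately show ?thesis
    using summable_sums[OF \<open>summable ?f\<close>] by (simp only:)
qed

text \<open>Under these assumptions \<open>u\<close> converges to \<open>l\<close> in the tau norm: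
  the component in the complement by hypothesis, the weighted norm of the \<open>Y\<close>-component
  by dominated convergence.\<close>

lemma tau_usc_sequentially:
  fixes Y :: "'a::{real_inner, complete_space} set"
  assumes Y: "subspace Y" "closed Y" and \<theta>: "total_orthonormal Y J \<theta>"
    and usc: "upper_semicontinuous (tau_topology Y J \<theta>) \<phi>"
    and weak: "weak_lim u l" and bounded: "\<And>n. norm (u n) \<le> C"
    and strong: "(\<lambda>n. u n - orth_proj Y (u n)) \<longlonglongrightarrow> l - orth_proj Y l"
    and c: "\<phi> l < c"
  shows "\<forall>\<^sub>F n in sequentially. \<phi> (u n) < c"
proof -
  interpret orthonormal_family Y J \<theta>
    using \<theta> by unfold_locales
  let ?P = "orth_proj Y"
  let ?w = "\<lambda>u. weighted_norm J \<theta> (?P u)"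
  have P: "?P u \<bullet> \<theta> j = u \<bullet> \<theta> j" if "j \<in> J" for u j
    using inner_orth_proj[OF Y b_in_H[OF that]] .
  have bound: "\<bar>?P u \<bullet> \<theta> j\<bar> \<le> norm u" if "j \<in> J" for u j
    using Cauchy_Schwarz_ineq2[of "?P u" "\<theta> j"] norm_orth_proj_le[OF Y, of u] norm_b[OF that] by simp
  have sums: "(\<lambda>j. if j \<in> J then (1 / 2) ^ (j + 1) * \<bar>?P u \<bullet> \<theta> j\<bar> else 0) sums ?w u" for u
    by (rule weighted_norm_sums[OF bound])
  have tau: "tau_norm Y J \<theta> u = max (?w u) (norm (u - ?P u))" for u
    by (simp add: tau_norm_def orth_proj_orthogonal_comp[OF Y])
  have minus: "?P (u - v) = ?P u - ?P v" for u v
    by (rule orth_proj_diff[OF Y])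
  \<comment> \<open>\<open>norm_topology\<close> is built for an arbitrary function; the description
    of its open sets by balls becomes available once the metric axioms hold.\<close>
  interpret M: Metric_space UNIV "\<lambda>u v. tau_norm Y J \<theta> (u - v)"
  proof
    show "0 \<le> tau_norm Y J \<theta> (u - v)" for u v
      by (simp add: tau le_max_iff_disj)
    show "tau_norm Y J \<theta> (u - v) = tau_norm Y J \<theta> (v - u)" for u v
      using norm_minus_commute[of "u - ?P u" "v - ?P v"]
      by (simp add: tau minus weighted_norm_minus_commute[of J \<theta> "?P u"] algebra_simps)
    show "tau_norm Y J \<theta> (u - v) = 0 \<longleftrightarrow> u = v" for u v
    proof
      assume 0: "tau_norm Y J \<theta> (u - v) = 0"
      then have w0: "?w (u - v) = 0" and "(u - v) - ?P (u - v) = 0"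
        using weighted_norm_nonneg[of J \<theta> "?P (u - v)"]
        by (auto simp: tau max_def split: if_splits)
      have "?P (u - v) \<bullet> \<theta> j = 0" if "j \<in> J" for j
      proof -
        have "(\<lambda>j. if j \<in> J then (1 / 2) ^ (j + 1) * \<bar>?P (u - v) \<bullet> \<theta> j\<bar> else 0) sums 0"
          using sums[of "u - v"] w0 by simp
        then have "\<forall>j. (if j \<in> J then (1 / 2) ^ (j + 1) * \<bar>?P (u - v) \<bullet> \<theta> j\<bar> else 0) = 0"
          by (subst suminf_eq_zero_iff[symmetric]) (auto simp: sums_iff)
        then show ?thesis
          using that by (metis abs_zero mult_eq_0_iff abs_eq_0 power_not_zero divide_eq_0_iff zero_neq_numeral zero_neq_one)
      qed
      then have "?P (u - v) = 0"
        using H_eqI_zero orth_proj_in[OF Y] by blast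
      then show "u = v"
        using \<open>(u - v) - ?P (u - v) = 0\<close> by simp
    next
      assume "u = v"
      then show "tau_norm Y J \<theta> (u - v) = 0"
        using orth_proj_diff[OF Y, of v v] by (simp add: tau weighted_norm_def)
    qed
    show "tau_norm Y J \<theta> (u - w) \<le> tau_norm Y J \<theta> (u - v) + tau_norm Y J \<theta> (v - w)" for u v w
    proof -
      have "?w (u - w) \<le> ?w (u - v) + ?w (v - w)"
      proof (rule sums_le[OF _ sums sums_add[OF sums sums]])
        show "(if j \<in> J then (1 / 2) ^ (j + 1) * \<bar>?P (u - w) \<bullet> \<theta> j\<bar> else 0)
          \<le> (if j \<in> J then (1 / 2) ^ (j + 1) * \<bar>?P (u - v) \<bullet> \<theta> j\<bar> else 0)
            + (if j \<in> J then (1 / 2) ^ (j + 1) * \<bar>?P (v - w) \<bullet> \<theta> j\<bar> else 0)" for j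
          using abs_triangle_ineq[of "(?P u - ?P v) \<bullet> \<theta> j" "(?P v - ?P w) \<bullet> \<theta> j"]
          by (simp add: distrib_left[symmetric] minus inner_diff_left)
      qed
      moreover have "norm ((u - w) - ?P (u - w)) \<le> norm ((u - v) - ?P (u - v)) + norm ((v - w) - ?P (v - w))"
        by (rule order_trans[OF _ norm_triangle_ineq]) (simp add: minus algebra_simps)
      ultimately show ?thesis
        unfolding tau by linarith
    qed
  qed
  have "openin M.mtopology {u. \<phi> u < c}"
    using usc[unfolded upper_semicontinuous_def tau_topology_def norm_topology_def] by simp
  then obtain r where r: "r > 0" "M.mball l r \<subseteq> {u. \<phi> u < c}"
    using c unfolding M.openin_mtopology by blast
  \<comment> \<open>Each term tends to zero by weak convergence and is dominated by a geometric one
    since \<open>u\<close> is bounded, so Tannery's theorem applies.\<close>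
  have "(\<lambda>n. ?w (u n - l)) \<longlonglongrightarrow> suminf (\<lambda>j::nat. 0::real)"
  proof -
    define a where "a = (\<lambda>j n. if j \<in> J then (1 / 2) ^ (j + 1) * \<bar>?P (u n - l) \<bullet> \<theta> j\<bar> else 0)"
    have "(\<lambda>n. a j n) \<longlonglongrightarrow> 0" for j
    proof (cases "j \<in> J")
      case True
      have "(\<lambda>n. (1 / 2) ^ (j + 1) * \<bar>u n \<bullet> \<theta> j - l \<bullet> \<theta> j\<bar>) \<longlonglongrightarrow> (1 / 2) ^ (j + 1) * \<bar>l \<bullet> \<theta> j - l \<bullet> \<theta> j\<bar>"
        using weak unfolding weak_lim_def
        by (intro tendsto_mult tendsto_rabs tendsto_diff tendsto_const) blast
      then show ?thesis
        using True by (simp add: a_def P inner_diff_left)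
    qed (simp add: a_def)
    moreover have "norm (a j n) \<le> (1 / 2) ^ (j + 1) * (C + norm l)" for j n
    proof (cases "j \<in> J")
      case True
      have "\<bar>?P (u n - l) \<bullet> \<theta> j\<bar> \<le> C + norm l"
        using bound[OF True, of "u n - l"] norm_triangle_ineq4[of "u n" l] bounded[of n] by linarith
      then show ?thesis
        using True by (simp add: a_def abs_mult)
    next
      case False
      then show ?thesis
        using bounded[of 0] norm_ge_zero[of "u 0"] norm_ge_zero[of l] by (simp add: a_def del: norm_ge_zero)
    qed
    then have "\<forall>\<^sub>F (j, n) in at_top \<times>\<^sub>F sequentially. norm (a j n) \<le> (1 / 2) ^ (j + 1) * (C + norm l)"
      by (intro always_eventually) auto
    moreover have "summable (\<lambda>j. (1 / 2) ^ (j + 1) * (C + norm l))"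
      by (intro summable_mult2 summable_ignore_initial_segment summable_geometric) auto
    ultimately have "(\<lambda>n. suminf (\<lambda>j. a j n)) \<longlonglongrightarrow> suminf (\<lambda>j::nat. 0::real)"
      using tannerys_theorem[of a "\<lambda>_. 0" sequentially "\<lambda>j. (1 / 2) ^ (j + 1) * (C + norm l)"]
      by (simp only: sequentially_bot not_False_eq_True)
    moreover have "suminf (\<lambda>j. a j n) = ?w (u n - l)" for n
      unfolding a_def using sums by (simp add: sums_iff)
    ultimately show ?thesis
      by simp
  qed
  then have "\<forall>\<^sub>F n in sequentially. ?w (u n - l) < r"
    using r(1) by (intro order_tendstoD(2)) auto
  moreover have "\<forall>\<^sub>F n in sequentially. norm ((u n - ?P (u n)) - (l - ?P l)) < r"
    using tendstoD[OF strong r(1)] by (simp add: dist_norm)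
  ultimately show ?thesis
  proof eventually_elim
    case (elim n)
    have "tau_norm Y J \<theta> (l - u n) < r"
      using elim by (subst M.commute) (simp add: tau minus algebra_simps)
    then show ?case
      using r(2) by (auto simp: M.mball_def)
  qed
qed

section \<open>Deformations\<close>

text \<open>From each element pass to a successor that achieves at least half of the decrease still
  possible. Beyond a bound \<open>l\<close> of such a chain, nothing is left to gain.\<close>

lemma brezis_browder:
  fixes \<Psi> :: "'s \<Rightarrow> real"
  assumes "a \<in> S"
    and refl: "\<And>x. x \<in> S \<Longrightarrow> r x x"
    and trans: "\<And>x y z. x \<in> S \<Longrightarrow> y \<in> S \<Longrightarrow> z \<in> S \<Longrightarrow> r x y \<Longrightarrow> r y z \<Longrightarrow> r x z"
    and mono: "\<And>x y. x \<in> S \<Longrightarrow> y \<in> S \<Longrightarrow> r x y \<Longrightarrow> \<Psi> y \<le> \<Psi> x"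
    and bounded: "\<And>x. x \<in> S \<Longrightarrow> L \<le> \<Psi> x"
    and chain: "\<And>f. (\<And>n::nat. f n \<in> S) \<Longrightarrow> (\<And>n. r (f n) (f (Suc n))) \<Longrightarrow> \<exists>l\<in>S. \<forall>n. r (f n) l"
  shows "\<exists>x\<in>S. \<forall>y\<in>S. r x y \<longrightarrow> \<Psi> y = \<Psi> x"
proof -
  have "\<exists>y. y \<in> S \<and> r x y \<and> (\<forall>z\<in>S. r x z \<longrightarrow> \<Psi> y \<le> (\<Psi> x + \<Psi> z) / 2)" if x: "x \<in> S" for x
  proof -
    define T where "T = {y \<in> S. r x y}"
    define i where "i = (INF y\<in>T. \<Psi> y)"
    have T: "T \<noteq> {}" "bdd_below (\<Psi> ` T)"
      using x refl bounded by (auto simp: T_def intro!: bdd_belowI2[where m=L])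
    have i: "i \<le> \<Psi> z" if "z \<in> T" for z
      unfolding i_def using T(2) that by (rule cINF_lower)
    show ?thesis
    proof (cases "\<Psi> x = i")
      case True
      then show ?thesis
        using x refl i by (intro exI[where x=x]) (auto simp: T_def)
    next
      case False
      then have "i < (\<Psi> x + i) / 2"
        using i[of x] x refl by (auto simp: T_def)
      then obtain y where y: "y \<in> T" "\<Psi> y < (\<Psi> x + i) / 2"
        using cINF_less_iff[OF T] unfolding i_def by blast
      have "\<Psi> y \<le> (\<Psi> x + \<Psi> z) / 2" if "z \<in> S" "r x z" for z
        using y(2) i[of z] that by (auto simp: T_def)
      then show ?thesis
        using y(1) by (auto simp: T_def)
    qed
  qed
  then have "\<exists>f. \<forall>n. f n \<in> S \<and>
      (r (f n) (f (Suc n)) \<and> (\<forall>z\<in>S. r (f n) z \<longrightarrow> \<Psi> (f (Suc n)) \<le> (\<Psi> (f n) + \<Psi> z) / 2))"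
    using \<open>a \<in> S\<close> by (intro dependent_nat_choice) auto
  then obtain f where f: "\<And>n. f n \<in> S" "\<And>n. r (f n) (f (Suc n))"
    and half: "\<And>n z. z \<in> S \<Longrightarrow> r (f n) z \<Longrightarrow> \<Psi> (f (Suc n)) \<le> (\<Psi> (f n) + \<Psi> z) / 2"
    by blast
  obtain l where l: "l \<in> S" "\<And>n. r (f n) l"
    using chain[of f] f by blast
  have "\<Psi> y = \<Psi> l" if y: "y \<in> S" "r l y" for y
  proof (rule antisym)
    show "\<Psi> y \<le> \<Psi> l"
      using mono l(1) y by blast
    \<comment> \<open>An element above \<open>l\<close> lies above every \<open>f n\<close>, so the
      halving rule applies to it at each step and the gap shrinks geometrically.\<close>
    have *: "\<Psi> (f n) - \<Psi> y \<le> (\<Psi> (f 0) - \<Psi> y) * (1 / 2) ^ n" for n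
    proof (induction n)
      case (Suc n)
      have "r (f n) y"
        using trans f(1) l y by blast
      then show ?case
        using half[OF y(1), of n] Suc.IH by simp
    qed simp
    have "(\<lambda>n. (\<Psi> (f 0) - \<Psi> y) * (1 / 2) ^ n) \<longlonglongrightarrow> (\<Psi> (f 0) - \<Psi> y) * 0"
      by (intro tendsto_mult tendsto_const LIMSEQ_power_zero) auto
    moreover have "\<Psi> l - \<Psi> y \<le> (\<Psi> (f 0) - \<Psi> y) * (1 / 2) ^ n" for n
      using *[of n] mono[OF f(1) l(1) l(2), of n] by linarith
    ultimately have "\<Psi> l - \<Psi> y \<le> (\<Psi> (f 0) - \<Psi> y) * 0"
      by (intro LIMSEQ_le_const) auto
    then show "\<Psi> l \<le> \<Psi> y"
      by simp
  qed
  then show ?thesis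
    using l(1) by blast
qed

text \<open>The function \<open>\<phi> (a - t *\<^sub>R v) + t * c\<close> of \<open>t\<close> has
  nonpositive derivative on \<open>{0..h}\<close>.\<close>

lemma descent_along_segment:
  fixes \<phi> :: "'a::{real_inner, complete_space} \<Rightarrow> real"
  assumes diff: "\<And>u. \<phi> differentiable (at u)" and "h \<ge> 0"
    and slope: "\<And>t. 0 \<le> t \<Longrightarrow> t \<le> h \<Longrightarrow> grad \<phi> (a - t *\<^sub>R v) \<bullet> v \<ge> c"
  shows "\<phi> (a - h *\<^sub>R v) \<le> \<phi> a - h * c"
proof -
  have deriv: "((\<lambda>t. \<phi> (a - t *\<^sub>R v)) has_real_derivative - (grad \<phi> (a - t *\<^sub>R v) \<bullet> v)) (at t)" for t
  proof -
    have "((\<lambda>t. a - t *\<^sub>R v) has_derivative (\<lambda>s. - (s *\<^sub>R v))) (at t)"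
      by (auto intro!: derivative_eq_intros)
    then have "((\<lambda>t. \<phi> (a - t *\<^sub>R v)) has_derivative (\<lambda>s. (- (s *\<^sub>R v)) \<bullet> grad \<phi> (a - t *\<^sub>R v))) (at t)"
      by (rule has_derivative_compose) (rule GDERIV_grad[OF diff, unfolded gderiv_def])
    then show ?thesis
      by (rule has_derivative_imp_has_field_derivative) (simp add: inner_commute)
  qed
  have "\<exists>y. ((\<lambda>t. \<phi> (a - t *\<^sub>R v) + t * c) has_real_derivative y) (at t) \<and> y \<le> 0"
    if "0 \<le> t" "t \<le> h" for t
    using slope[OF that]
    by (intro exI[where x="- (grad \<phi> (a - t *\<^sub>R v) \<bullet> v) + c"]) (auto intro!: derivative_eq_intros deriv)
  then have "\<phi> (a - h *\<^sub>R v) + h * c \<le> \<phi> (a - 0 *\<^sub>R v) + 0 * c"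
    using \<open>h \<ge> 0\<close> by (intro DERIV_nonpos_imp_nonincreasing[of 0 h]) auto
  then show ?thesis
    by simp
qed

section \<open>Odd deformations of the ball\<close>

definition flip :: "real \<times> (nat \<Rightarrow> real) \<Rightarrow> real \<times> (nat \<Rightarrow> real)" where
  "flip p = (fst p, \<lambda>j. - snd p j)"

lemma flip_flip [simp]: "flip (flip p) = p"
  by (simp add: flip_def)

lemma fst_flip [simp]: "fst (flip p) = fst p"
  by (simp add: flip_def)

lemma continuous_on_flip: "continuous_on S flip"
proof -
  have "continuous_on S (\<lambda>p::real \<times> (nat \<Rightarrow> real). snd p j)" for j
    by (rule continuous_on_product_then_coordinatewise) (rule continuous_on_snd[OF continuous_on_id])
  then show ?thesis
    unfolding flip_def
    by (intro continuous_on_Pair continuous_on_coordinatewise_then_product continuous_on_minus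
        continuous_on_fst[OF continuous_on_id])
qed

text \<open>The assumption \<open>usc\<close> is tau-upper semicontinuity seen in coordinates: the
  vector of the ball converges weakly, the correction subtracted from it in norm.\<close>

locale deformation_setting = orthonormal_family H I b
  for H :: "'a::{real_inner, complete_space} set" and I b +
  fixes \<phi> :: "'a \<Rightarrow> real" and R d :: real
  assumes diff: "\<And>u. \<phi> differentiable (at u)"
    and even: "\<And>u. \<phi> (- u) = \<phi> u"
    and grad_weak: "weakly_seq_continuous (grad \<phi>)"
    and usc: "\<And>x y w v c. (\<And>n. x n \<in> coord_ball I R) \<Longrightarrow> y \<in> coord_ball I R \<Longrightarrow> x \<longlonglongrightarrow> y \<Longrightarrow>
      w \<longlonglongrightarrow> v \<Longrightarrow> \<phi> (series b y - v) < c \<Longrightarrow> \<forall>\<^sub>F n in sequentially. \<phi> (series b (x n) - w n) < c"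
    and R_pos: "R > 0"
    and upper: "\<And>u. u \<in> H \<Longrightarrow> norm u \<le> R \<Longrightarrow> \<phi> u \<le> d"
begin

definition K where "K = {0..1::real} \<times> coord_ball I R"

definition move where "move g p = series b (snd p) - g p"

text \<open>Continuity refers to the product topology on \<open>K\<close>, so corrections vary in
  norm even where the vectors vary only weakly. Vanishing at time 0 keeps the sphere of radius
  \<open>R\<close> fixed in the Galerkin argument; the last condition carries height bounds from the
  moved point back to the original one.\<close>

definition deformations where
  "deformations = {g. continuous_on K g \<and> (\<forall>p\<in>K. g (flip p) = - g p) \<and>
     (\<forall>p\<in>K. fst p = 0 \<longrightarrow> g p = 0) \<and> (\<forall>p\<in>K. \<phi> (move g p) \<le> \<phi> (series b (snd p)))}"

definition peak where "peak g = (SUP x\<in>coord_ball I R. \<phi> (move g (1, x)))"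

lemma compact_K: "compact K"
  unfolding K_def by (intro compact_Times compact_coord_ball) auto

lemma zero_in_coord_ball: "(\<lambda>_. 0) \<in> coord_ball I R"
  by (simp add: coord_ball_def)

lemma flip_in_K: "p \<in> K \<Longrightarrow> flip p \<in> K"
  by (auto simp: K_def flip_def coord_ball_uminus)

lemma snd_in_coord_ball: "p \<in> K \<Longrightarrow> snd p \<in> coord_ball I R"
  by (auto simp: K_def)

text \<open>Differentiate the identity \<open>\<phi> (- v) = \<phi> v\<close>.\<close>

lemma grad_uminus: "grad \<phi> (- u) = - grad \<phi> u"
proof -
  have "((\<lambda>v. \<phi> (- v)) has_derivative (\<lambda>h. (- h) \<bullet> grad \<phi> (- u))) (at u)"
    by (rule has_derivative_compose[OF _ GDERIV_grad[OF diff, unfolded gderiv_def]])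
      (auto intro!: derivative_eq_intros)
  then have "(\<phi> has_derivative (\<lambda>h. (- h) \<bullet> grad \<phi> (- u))) (at u)"
    by (simp add: even)
  then have "(\<lambda>h. (- h) \<bullet> grad \<phi> (- u)) = (\<lambda>h. h \<bullet> grad \<phi> u)"
    by (rule has_derivative_unique[OF _ GDERIV_grad[OF diff, unfolded gderiv_def]])
  then have "h \<bullet> grad \<phi> (- u) = h \<bullet> (- grad \<phi> u)" for h
    by (metis inner_minus_left inner_minus_right minus_minus)
  then show ?thesis
    using vector_eq_ldot by blast
qed

lemma isCont_\<phi>: "isCont \<phi> u"
  using diff differentiable_imp_continuous_within by blast

lemma move_le_upper: "g \<in> deformations \<Longrightarrow> p \<in> K \<Longrightarrow> \<phi> (move g p) \<le> d"
  using upper[OF series_in_H norm_series_le, of "snd p" R] R_pos snd_in_coord_ball[of p]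
  by (fastforce simp: deformations_def)

lemma bdd_above_peak: "g \<in> deformations \<Longrightarrow> bdd_above ((\<lambda>x. \<phi> (move g (1, x))) ` coord_ball I R)"
  using move_le_upper by (intro bdd_aboveI2[where M=d]) (auto simp: K_def)

lemma move_le_peak: "g \<in> deformations \<Longrightarrow> x \<in> coord_ball I R \<Longrightarrow> \<phi> (move g (1, x)) \<le> peak g"
  unfolding peak_def by (rule cSUP_upper[OF _ bdd_above_peak])

lemma peak_le: "(\<And>x. x \<in> coord_ball I R \<Longrightarrow> \<phi> (move g (1, x)) \<le> c) \<Longrightarrow> peak g \<le> c"
  unfolding peak_def using zero_in_coord_ball by (intro cSUP_least) auto

lemma zero_in_deformations: "(\<lambda>_. 0) \<in> deformations"
  by (simp add: deformations_def move_def)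

lemma move_flip: "g \<in> deformations \<Longrightarrow> p \<in> K \<Longrightarrow> move g (flip p) = - move g p"
  using series_uminus[OF snd_in_coord_ball[of p]] by (simp add: move_def deformations_def flip_def)

lemma deformation_LIMSEQ:
  assumes "g \<in> deformations" "\<And>n. q n \<in> K" "p \<in> K" "q \<longlonglongrightarrow> p"
  shows "(\<lambda>n. g (q n)) \<longlonglongrightarrow> g p"
  using assms by (auto simp: deformations_def intro: continuous_on_tendsto_compose[of K g])

lemma move_weak_lim:
  assumes g: "g \<in> deformations" and q: "\<And>n. q n \<in> K" "p \<in> K" "q \<longlonglongrightarrow> p"
  shows "weak_lim (\<lambda>n. move g (q n)) (move g p)"
  unfolding move_def
proof (rule weak_lim_diff)
  show "weak_lim (\<lambda>n. series b (snd (q n))) (series b (snd p))"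
    using R_pos q by (intro series_weak_lim[where R=R] snd_in_coord_ball tendsto_snd) auto
  show "weak_lim (\<lambda>n. g (q n)) (g p)"
    by (intro weak_lim_tendsto deformation_LIMSEQ assms)
qed

text \<open>Upper semicontinuity in coordinates makes the superlevel set sequentially closed in the
  compact set \<open>K\<close>.\<close>

lemma compact_superlevel:
  assumes g: "g \<in> deformations"
  shows "compact {p \<in> K. c \<le> \<phi> (move g p)}"
proof -
  have "closed {p \<in> K. c \<le> \<phi> (move g p)}"
    unfolding closed_sequential_limits
  proof (intro allI impI, elim conjE)
    fix q p assume q: "\<forall>n. q n \<in> {p \<in> K. c \<le> \<phi> (move g p)}" and lim: "q \<longlonglongrightarrow> p"
    have p: "p \<in> K"
      using closed_sequentially[OF compact_imp_closed[OF compact_K] _ lim] q by blast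
    have "\<not> \<phi> (move g p) < c"
    proof
      assume "\<phi> (move g p) < c"
      then have "\<forall>\<^sub>F n in sequentially. \<phi> (series b (snd (q n)) - g (q n)) < c"
        using q p lim g unfolding move_def
        by (intro usc[of "\<lambda>n. snd (q n)" "snd p" "\<lambda>n. g (q n)" "g p"] snd_in_coord_ball tendsto_snd
            deformation_LIMSEQ) auto
      then obtain n where "\<phi> (move g (q n)) < c"
        unfolding move_def eventually_sequentially by blast
      then show False
        using q by (auto simp: not_le[symmetric])
    qed
    then show "p \<in> {p \<in> K. c \<le> \<phi> (move g p)}"
      using p by simp
  qed
  then have "compact (K \<inter> {p \<in> K. c \<le> \<phi> (move g p)})"
    by (rule compact_Int_closed[OF compact_K])
  moreover have "K \<inter> {p \<in> K. c \<le> \<phi> (move g p)} = {p \<in> K. c \<le> \<phi> (move g p)}"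
    by blast
  ultimately show ?thesis
    by (simp only:)
qed

text \<open>Failure would give \<open>q n\<close> tending to \<open>p\<close> and \<open>y n\<close>
  tending to 0. The points \<open>move g (q n) - y n\<close> then converge weakly, hence so do their
  gradients. The variable \<open>y\<close> leaves room for the whole segment of descent.\<close>

lemma slope_neighbourhood:
  assumes g: "g \<in> deformations" and p: "p \<in> K" and c: "c < grad \<phi> (move g p) \<bullet> w"
  shows "\<exists>\<epsilon>>0. \<forall>q\<in>K. dist q p < \<epsilon> \<longrightarrow> (\<forall>y. norm y \<le> \<epsilon> \<longrightarrow> c \<le> grad \<phi> (move g q - y) \<bullet> w)"
proof (rule ccontr)
  assume contra: "\<not> ?thesis"
  have "\<exists>q y. q \<in> K \<and> dist q p < inverse (real (Suc n)) \<and> norm y \<le> inverse (real (Suc n)) \<and>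
      grad \<phi> (move g q - y) \<bullet> w < c" for n
  proof -
    have "inverse (real (Suc n)) > 0"
      by simp
    then show ?thesis
      using contra by (metis not_le)
  qed
  then obtain q y where q: "\<And>n. q n \<in> K" "\<And>n. dist (q n) p < inverse (real (Suc n))"
    and y: "\<And>n. norm (y n) \<le> inverse (real (Suc n))"
    and less: "\<And>n. grad \<phi> (move g (q n) - y n) \<bullet> w < c"
    by metis
  have "q \<longlonglongrightarrow> p"
    using q(2) by (intro tendstoI metric_tendsto_imp_tendsto[OF LIMSEQ_inverse_real_of_nat, THEN tendstoD])
      (auto simp: less_imp_le)
  moreover have "y \<longlonglongrightarrow> 0"
    using y by (intro Lim_null_comparison[OF _ LIMSEQ_inverse_real_of_nat]) auto
  ultimately have "weak_lim (\<lambda>n. move g (q n) - y n) (move g p - 0)"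
    by (intro weak_lim_diff move_weak_lim weak_lim_tendsto g q(1) p)
  then have "(\<lambda>n. grad \<phi> (move g (q n) - y n) \<bullet> w) \<longlonglongrightarrow> grad \<phi> (move g p) \<bullet> w"
    using grad_weak by (auto simp: weakly_seq_continuous_def weak_lim_def)
  then have "\<forall>\<^sub>F n in sequentially. c < grad \<phi> (move g (q n) - y n) \<bullet> w"
    using c by (rule order_tendstoD(1))
  then show False
    using less by (auto simp: eventually_sequentially) (meson less_asym order_refl)
qed

text \<open>Normalised gradients at finitely many points of the compact set \<open>C\<close> are
  glued by a partition of unity, and the odd part of the result is taken. Near each chosen point its
  direction still descends, by \<open>slope_neighbourhood\<close>.\<close>

lemma descent_field:
  assumes g: "g \<in> deformations" and \<delta>: "\<delta> > 0"
    and slope: "\<And>v. c \<le> \<phi> v \<Longrightarrow> \<phi> v \<le> d \<Longrightarrow> \<delta> \<le> norm (grad \<phi> v)"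
  shows "\<exists>V \<epsilon>. \<epsilon> > 0 \<and> continuous_on K V \<and> (\<forall>q\<in>K. norm (V q) \<le> 1 \<and> V (flip q) = - V q \<and>
    (\<forall>y. norm y \<le> \<epsilon> \<longrightarrow> 0 \<le> grad \<phi> (move g q - y) \<bullet> V q \<and>
       (c \<le> \<phi> (move g q) \<longrightarrow> \<delta> / 2 \<le> grad \<phi> (move g q - y) \<bullet> V q)))"
proof -
  define C where "C = {p \<in> K. c \<le> \<phi> (move g p)}"
  have "compact C"
    unfolding C_def by (rule compact_superlevel[OF g])
  have "\<exists>w \<epsilon>. norm w = 1 \<and> \<epsilon> > 0 \<and>
      (\<forall>q\<in>K. dist q p < \<epsilon> \<longrightarrow> (\<forall>y. norm y \<le> \<epsilon> \<longrightarrow> \<delta> / 2 \<le> grad \<phi> (move g q - y) \<bullet> w))" if p: "p \<in> C" for p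
  proof -
    let ?v = "grad \<phi> (move g p)"
    have v: "\<delta> \<le> norm ?v"
      using p slope move_le_upper[OF g] by (auto simp: C_def)
    then have "?v \<bullet> sgn ?v = norm ?v"
      using \<delta> by (simp add: sgn_div_norm power2_norm_eq_inner[symmetric] power2_eq_square field_simps)
    then have "\<delta> / 2 < ?v \<bullet> sgn ?v"
      using v \<delta> by simp
    moreover have "norm (sgn ?v) = 1"
      using v \<delta> by (auto simp: norm_sgn)
    ultimately show ?thesis
      using slope_neighbourhood[OF g] p unfolding C_def by blast
  qed
  then obtain w \<epsilon> where w: "\<And>p. p \<in> C \<Longrightarrow> norm (w p) = 1" and \<epsilon>: "\<And>p. p \<in> C \<Longrightarrow> \<epsilon> p > 0"
    and near: "\<And>p q y. p \<in> C \<Longrightarrow> q \<in> K \<Longrightarrow> dist q p < \<epsilon> p \<Longrightarrow> norm y \<le> \<epsilon> p \<Longrightarrow>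
        \<delta> / 2 \<le> grad \<phi> (move g q - y) \<bullet> w p"
    by metis
  have "C \<subseteq> (\<Union>p\<in>C. ball p (\<epsilon> p))"
    using \<epsilon> by (intro subsetI UN_I) auto
  then obtain D where D: "D \<subseteq> C" "finite D" "C \<subseteq> (\<Union>p\<in>D. ball p (\<epsilon> p))"
    by (rule compactE_image[OF \<open>compact C\<close>, rotated]) auto
  \<comment> \<open>Hat functions supported in the balls of the finite cover; divided by their sum
    \<open>L\<close> they form a partition of unity on \<open>C\<close>.\<close>
  define l where "l p q = max 0 (\<epsilon> p - dist q p)" for p q
  define L where "L q = (\<Sum>p\<in>D. l p q)" for q
  have l_nonneg: "l p q \<ge> 0" for p q
    by (simp add: l_def)
  have cont_l: "continuous_on S (l p)" for S p
    unfolding l_def by (intro continuous_intros)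
  have cont_L: "continuous_on S L" for S
    unfolding L_def by (intro continuous_intros cont_l)
  have L_pos: "L q > 0" if q: "q \<in> C" for q
  proof -
    obtain p where "p \<in> D" "dist p q < \<epsilon> p"
      using q D(3) by auto
    then have "0 < l p q"
      by (simp add: l_def dist_commute)
    then show ?thesis
      unfolding L_def using \<open>p \<in> D\<close> D(2) l_nonneg by (intro sum_pos2[of _ p]) auto
  qed
  \<comment> \<open>Dividing by \<open>max \<mu> (L q)\<close> extends the field continuously to all
    of \<open>K\<close>, including points where \<open>L\<close> vanishes; on \<open>C\<close> this
    is division by \<open>L q\<close>.\<close>
  obtain \<mu> where \<mu>: "\<mu> > 0" "\<And>q. q \<in> C \<Longrightarrow> \<mu> \<le> L q"
  proof (cases "C = {}")
    case True
    then show ?thesis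
      using that[of 1] by simp
  next
    case False
    then obtain q where "q \<in> C" "\<And>q'. q' \<in> C \<Longrightarrow> L q \<le> L q'"
      using continuous_attains_inf[OF \<open>compact C\<close> _ cont_L] by blast
    then show ?thesis
      using that L_pos by blast
  qed
  define W where "W q = (1 / max \<mu> (L q)) *\<^sub>R (\<Sum>p\<in>D. l p q *\<^sub>R w p)" for q
  \<comment> \<open>Inserting 1 keeps the minimum meaningful when \<open>D\<close> is empty.\<close>
  obtain \<epsilon>0 where \<epsilon>0: "\<epsilon>0 > 0" "\<And>p. p \<in> D \<Longrightarrow> \<epsilon>0 \<le> \<epsilon> p"
  proof -
    have "Min (insert 1 (\<epsilon> ` D)) > 0"
      using D(1,2) \<epsilon> by auto
    moreover have "Min (insert 1 (\<epsilon> ` D)) \<le> \<epsilon> p" if "p \<in> D" for p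
      using D(2) that by (intro Min_le) auto
    ultimately show ?thesis
      using that by blast
  qed
  have max_pos: "max \<mu> (L q) > 0" for q
    using \<mu>(1) by linarith
  have cont_W: "continuous_on K W"
    unfolding W_def using max_pos
    by (intro continuous_intros cont_l cont_L) (metis less_irrefl)
  have norm_W: "norm (W q) \<le> 1" for q
  proof -
    have "norm (\<Sum>p\<in>D. l p q *\<^sub>R w p) \<le> (\<Sum>p\<in>D. norm (l p q *\<^sub>R w p))"
      by (rule norm_sum)
    also have "\<dots> = L q"
      unfolding L_def using D(1) w l_nonneg by (intro sum.cong) auto
    finally show ?thesis
      using max_pos[of q] by (simp add: W_def field_simps)
  qed
  have slope_sum: "L q * (\<delta> / 2) \<le> grad \<phi> (move g q - y) \<bullet> (\<Sum>p\<in>D. l p q *\<^sub>R w p)"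
    if q: "q \<in> K" and y: "norm y \<le> \<epsilon>0" for q y
    unfolding L_def sum_distrib_right inner_sum_right inner_scaleR_right
  proof (intro sum_mono)
    fix p assume p: "p \<in> D"
    show "l p q * (\<delta> / 2) \<le> l p q * (grad \<phi> (move g q - y) \<bullet> w p)"
    proof (cases "dist q p < \<epsilon> p")
      case True
      have "\<delta> / 2 \<le> grad \<phi> (move g q - y) \<bullet> w p"
        using p D(1) q y \<epsilon>0(2)[OF p] True by (intro near) auto
      then show ?thesis
        by (intro mult_left_mono l_nonneg)
    qed (simp add: l_def)
  qed
  have W1: "0 \<le> grad \<phi> (move g q - y) \<bullet> W q" if "q \<in> K" "norm y \<le> \<epsilon>0" for q y
  proof -
    have "0 \<le> L q * (\<delta> / 2)"
      unfolding L_def using \<delta> by (intro mult_nonneg_nonneg sum_nonneg l_nonneg) simp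
    then show ?thesis
      using slope_sum[OF that] max_pos[of q] by (auto simp: W_def)
  qed
  have W2: "\<delta> / 2 \<le> grad \<phi> (move g q - y) \<bullet> W q" if "q \<in> C" "norm y \<le> \<epsilon>0" for q y
  proof -
    have "q \<in> K" "max \<mu> (L q) = L q"
      using that \<mu>(2) by (auto simp: C_def)
    then show ?thesis
      using slope_sum[of q y] that L_pos[OF that(1)] by (simp add: W_def field_simps)
  qed
  have C_flip: "flip q \<in> C" if "q \<in> C" for q
    using that move_flip[OF g] flip_in_K by (auto simp: C_def even)
  \<comment> \<open>The odd part of \<open>W\<close>. Since the gradient is odd and \<open>C\<close>
    is stable under \<open>flip\<close>, both summands satisfy the same lower bound.\<close>
  define V where "V q = (1 / 2) *\<^sub>R (W q - W (flip q))" for q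
  have grad_flip: "grad \<phi> (move g q - y) \<bullet> V q =
      (1 / 2) * (grad \<phi> (move g q - y) \<bullet> W q + grad \<phi> (move g (flip q) - (- y)) \<bullet> W (flip q))"
    if "q \<in> K" for q y
    using grad_uminus[of "move g q - y"] move_flip[OF g that]
    by (simp add: V_def inner_diff_right algebra_simps)
  have "continuous_on K (\<lambda>q. W (flip q))"
    by (rule continuous_on_compose2[OF cont_W continuous_on_flip]) (auto simp: flip_in_K)
  then have "continuous_on K V"
    unfolding V_def by (intro continuous_intros cont_W)
  moreover have "norm (V q) \<le> 1" for q
    using norm_triangle_ineq4[of "W q" "W (flip q)"] norm_W[of q] norm_W[of "flip q"]
    by (simp add: V_def)
  moreover have "V (flip q) = - V q" for q
    by (simp add: V_def algebra_simps)
  moreover have "0 \<le> grad \<phi> (move g q - y) \<bullet> V q" if "q \<in> K" "norm y \<le> \<epsilon>0" for q y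
    using W1[OF that] W1[OF flip_in_K, of q "- y"] that grad_flip[OF that(1), of y] by simp
  moreover have "\<delta> / 2 \<le> grad \<phi> (move g q - y) \<bullet> V q" if "q \<in> C" "norm y \<le> \<epsilon>0" for q y
    using W2[OF that] W2[OF C_flip, of q "- y"] that grad_flip[of q y] by (simp add: C_def)
  ultimately show ?thesis
    using \<epsilon>0(1) by (intro exI[where x=V] exI[where x=\<epsilon>0]) (auto simp: C_def)
qed

text \<open>Moving further along the descent field lowers all points that are above
  \<open>c\<close>, at a rate of at least \<open>\<delta> / 2\<close> at time 1, while the
  correction changes by at most the distance moved.\<close>

lemma lower_peak:
  assumes g: "g \<in> deformations" and \<delta>: "\<delta> > 0" and c: "c < peak g"
    and slope: "\<And>v. c \<le> \<phi> v \<Longrightarrow> \<phi> v \<le> d \<Longrightarrow> \<delta> \<le> norm (grad \<phi> v)"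
  shows "\<exists>h\<in>deformations. peak h < peak g \<and> (\<forall>p\<in>K. \<delta> / 2 * norm (g p - h p) \<le> peak g - peak h)"
proof -
  obtain V \<epsilon> where \<epsilon>: "\<epsilon> > 0" and contV: "continuous_on K V"
    and V: "\<And>q. q \<in> K \<Longrightarrow> norm (V q) \<le> 1" "\<And>q. q \<in> K \<Longrightarrow> V (flip q) = - V q"
    and V1: "\<And>q y. q \<in> K \<Longrightarrow> norm y \<le> \<epsilon> \<Longrightarrow> 0 \<le> grad \<phi> (move g q - y) \<bullet> V q"
    and V2: "\<And>q y. q \<in> K \<Longrightarrow> norm y \<le> \<epsilon> \<Longrightarrow> c \<le> \<phi> (move g q) \<Longrightarrow> \<delta> / 2 \<le> grad \<phi> (move g q - y) \<bullet> V q"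
    using descent_field[OF g \<delta> slope] by blast
  \<comment> \<open>The first bound keeps the segment where the field descends. The second ensures
    that points starting below \<open>c\<close> stay below the new peak estimate
    \<open>peak g - s * (\<delta> / 2)\<close>.\<close>
  define s where "s = min \<epsilon> ((peak g - c) / \<delta>)"
  have s: "s > 0" "s \<le> \<epsilon>" "s * (\<delta> / 2) \<le> peak g - c"
  proof -
    show "s > 0" "s \<le> \<epsilon>"
      using \<epsilon> c \<delta> by (auto simp: s_def)
    have "s * \<delta> \<le> ((peak g - c) / \<delta>) * \<delta>"
      using \<delta> by (intro mult_right_mono) (auto simp: s_def)
    then show "s * (\<delta> / 2) \<le> peak g - c"
      using \<delta> c by simp
  qed
  \<comment> \<open>The factor \<open>fst q\<close> preserves the zero correction at time 0 and
    gives the full step \<open>s\<close> at time 1.\<close>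
  define h where "h q = g q + (s * fst q) *\<^sub>R V q" for q
  have move_h: "move h q = move g q - (s * fst q) *\<^sub>R V q" for q
    by (simp add: move_def h_def)
  have fst01: "0 \<le> fst q" "fst q \<le> 1" if "q \<in> K" for q
    using that by (auto simp: K_def)
  have small: "norm (t *\<^sub>R V q) \<le> \<epsilon>" if "q \<in> K" "0 \<le> t" "t \<le> s * fst q" for t q
  proof -
    have "norm (t *\<^sub>R V q) \<le> t * 1"
      using V(1)[OF that(1)] that(2) by (simp add: mult_left_le)
    also have "\<dots> \<le> s * 1"
      using order_trans[OF that(3) mult_left_mono[OF fst01(2)[OF that(1)]]] s(1) by simp
    finally show ?thesis
      using s(2) by simp
  qed
  have le1: "\<phi> (move h q) \<le> \<phi> (move g q)" if "q \<in> K" for q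
    using descent_along_segment[OF diff, of "s * fst q" 0 "move g q" "V q"] s(1) fst01[OF that] V1[OF that small[OF that]]
    by (simp add: move_h)
  have le2: "\<phi> (move h q) \<le> \<phi> (move g q) - s * (\<delta> / 2)" if "q \<in> K" "c \<le> \<phi> (move g q)" "fst q = 1" for q
    using descent_along_segment[OF diff, of "s * fst q" "\<delta> / 2" "move g q" "V q"] s(1)
      V2[OF that(1) small[OF that(1)] that(2)] that(3)
    by (simp add: move_h)
  have "h \<in> deformations"
    using g V(2) fst01 order_trans[OF le1] flip_in_K unfolding deformations_def
    by (auto simp: h_def intro!: continuous_intros contV)
  have peak_h: "peak h \<le> peak g - s * (\<delta> / 2)"
  proof (rule peak_le)
    fix x assume x: "x \<in> coord_ball I R"
    then have K: "(1, x) \<in> K"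
      by (simp add: K_def)
    show "\<phi> (move h (1, x)) \<le> peak g - s * (\<delta> / 2)"
    proof (cases "c \<le> \<phi> (move g (1, x))")
      case True
      then show ?thesis
        using le2[OF K] move_le_peak[OF g x] by simp
    next
      case False
      then show ?thesis
        using le1[OF K] s(3) by linarith
    qed
  qed
  moreover have "s * (\<delta> / 2) > 0"
    using s(1) \<delta> by simp
  moreover have "\<delta> / 2 * norm (g p - h p) \<le> s * (\<delta> / 2)" if "p \<in> K" for p
  proof -
    have "norm (g p - h p) = s * fst p * norm (V p)"
      using s(1) fst01[OF that] by (simp add: h_def abs_mult)
    also have "\<dots> \<le> s * 1 * 1"
      using V(1)[OF that] fst01[OF that] s(1) by (intro mult_mono) auto
    finally show ?thesis
      using \<delta> by (simp add: field_simps)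
  qed
  ultimately show ?thesis
    using \<open>h \<in> deformations\<close> by (intro bexI[where x=h]) fastforce+
qed

text \<open>The peaks decrease and are bounded below, so the step inequality makes \<open>f\<close>
  uniformly Cauchy on \<open>K\<close>; all conditions defining \<open>deformations\<close> survive
  the uniform limit.\<close>

lemma deformations_chain_limit:
  fixes f :: "nat \<Rightarrow> real \<times> (nat \<Rightarrow> real) \<Rightarrow> 'a"
  assumes k: "k > 0" and f: "\<And>n. f n \<in> deformations"
    and step: "\<And>n p. p \<in> K \<Longrightarrow> k * norm (f n p - f (Suc n) p) \<le> peak (f n) - peak (f (Suc n))"
    and bounded: "\<And>n. c \<le> peak (f n)"
  shows "\<exists>l\<in>deformations. \<forall>n. \<forall>p\<in>K. k * norm (f n p - l p) \<le> peak (f n) - peak l"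
proof -
  have f': "continuous_on K (f n)" "p \<in> K \<Longrightarrow> f n (flip p) = - f n p"
    "p \<in> K \<Longrightarrow> fst p = 0 \<Longrightarrow> f n p = 0" "p \<in> K \<Longrightarrow> \<phi> (move (f n) p) \<le> \<phi> (series b (snd p))" for n p
    using f[of n] by (auto simp: deformations_def)
  have dist: "k * norm (f n p - f m p) \<le> peak (f n) - peak (f m)" if "n \<le> m" "p \<in> K" for n m p
    using that(1)
  proof (induction m rule: dec_induct)
    case (step m)
    have "norm (f n p - f (Suc m) p) \<le> norm (f n p - f m p) + norm (f m p - f (Suc m) p)"
      using norm_triangle_ineq[of "f n p - f m p" "f m p - f (Suc m) p"] by simp
    then have "k * norm (f n p - f (Suc m) p) \<le> k * norm (f n p - f m p) + k * norm (f m p - f (Suc m) p)"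
      using k by (simp add: distrib_left[symmetric])
    then show ?case
      using step.IH assms(3)[OF that(2), of m] by linarith
  qed simp
  have p0: "(0, \<lambda>_. 0) \<in> K"
    using zero_in_coord_ball by (simp add: K_def)
  have anti: "peak (f m) \<le> peak (f n)" if "n \<le> m" for n m
    using dist[OF that p0] k by (smt (verit) mult_nonneg_nonneg norm_ge_zero)
  have "decseq (\<lambda>n. peak (f n))"
    using anti by (simp add: decseq_def)
  then obtain P where "(\<lambda>n. peak (f n)) \<longlonglongrightarrow> P"
    using decseq_convergent[of "\<lambda>n. peak (f n)" c] bounded by blast
  then have "Cauchy (\<lambda>n. peak (f n))"
    by (rule LIMSEQ_imp_Cauchy)
  have "uniformly_Cauchy_on K f"
    unfolding uniformly_Cauchy_on_def
  proof (intro allI impI)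
    fix \<epsilon> :: real assume "\<epsilon> > 0"
    then obtain M where M: "\<And>m n. m \<ge> M \<Longrightarrow> n \<ge> M \<Longrightarrow> dist (peak (f m)) (peak (f n)) < k * \<epsilon>"
      using metric_CauchyD[OF \<open>Cauchy (\<lambda>n. peak (f n))\<close>, of "k * \<epsilon>"] k by auto
    have *: "dist (f n p) (f m p) < \<epsilon>" if "p \<in> K" "M \<le> n" "n \<le> m" for p m n
    proof -
      have "k * norm (f n p - f m p) < k * \<epsilon>"
        using dist[OF that(3,1)] M[of n m] that by (auto simp: dist_real_def)
      then show ?thesis
        using k by (simp add: dist_norm)
    qed
    have "dist (f m p) (f n p) < \<epsilon>" if "p \<in> K" "m \<ge> M" "n \<ge> M" for p m n
      using *[of p n m] *[of p m n] that by (cases "n \<le> m") (auto simp: dist_commute)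
    then show "\<exists>M. \<forall>x\<in>K. \<forall>m\<ge>M. \<forall>n\<ge>M. dist (f m x) (f n x) < \<epsilon>"
      by blast
  qed
  then obtain l where l: "uniform_limit K f l sequentially"
    using Cauchy_uniformly_convergent by (auto simp: uniformly_convergent_on_def)
  have lim: "(\<lambda>n. f n p) \<longlonglongrightarrow> l p" if "p \<in> K" for p
    using tendsto_uniform_limitI[OF l that] .
  have lim_\<phi>: "(\<lambda>n. \<phi> (move (f n) p)) \<longlonglongrightarrow> \<phi> (move l p)" if "p \<in> K" for p
    unfolding move_def using that by (intro isCont_tendsto_compose[OF isCont_\<phi>] tendsto_intros lim)
  have "l \<in> deformations"
    unfolding deformations_def
  proof (intro CollectI conjI ballI impI)
    show "continuous_on K l"
      using uniform_limit_theorem[OF _ l] f'(1) by simp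
    fix p assume p: "p \<in> K"
    show "l (flip p) = - l p"
      using LIMSEQ_unique[OF lim[OF flip_in_K[OF p]]] tendsto_minus[OF lim[OF p]] f'(2)[OF p] by simp
    show "l p = 0" if "fst p = 0"
      using LIMSEQ_unique[OF lim[OF p]] f'(3)[OF p that] by simp
    show "\<phi> (move l p) \<le> \<phi> (series b (snd p))"
      using f'(4)[OF p] by (intro LIMSEQ_le_const2[OF lim_\<phi>[OF p]]) auto
  qed
  \<comment> \<open>For later indices the moved points at time 1 stay below
    \<open>peak (f n)\<close>, and norm continuity of \<open>\<phi>\<close> passes this to the
    limit.\<close>
  have peak_l: "peak l \<le> peak (f n)" for n
  proof (rule peak_le)
    fix x assume x: "x \<in> coord_ball I R"
    then have K: "(1, x) \<in> K"
      by (simp add: K_def)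
    show "\<phi> (move l (1, x)) \<le> peak (f n)"
      using order_trans[OF move_le_peak[OF f x] anti]
      by (intro LIMSEQ_le_const2[OF lim_\<phi>[OF K]]) blast
  qed
  have "k * norm (f n p - l p) \<le> peak (f n) - peak l" if p: "p \<in> K" for n p
  proof (rule LIMSEQ_le_const2)
    show "(\<lambda>m. k * norm (f n p - f m p)) \<longlonglongrightarrow> k * norm (f n p - l p)"
      by (intro tendsto_intros lim p)
    show "\<exists>N. \<forall>m\<ge>N. k * norm (f n p - f m p) \<le> peak (f n) - peak l"
      using order_trans[OF dist[OF _ p] diff_left_mono[OF peak_l]] by blast
  qed
  then show ?thesis
    using \<open>l \<in> deformations\<close> by blast
qed

text \<open>The ordering principle yields a deformation above which no peak is lower, whereas
  \<open>lower_peak\<close> always produces one.\<close>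

lemma peak_lower_bound_false:
  assumes \<delta>: "\<delta> > 0" and c: "\<And>g. g \<in> deformations \<Longrightarrow> c < peak g"
    and slope: "\<And>v. c \<le> \<phi> v \<Longrightarrow> \<phi> v \<le> d \<Longrightarrow> \<delta> \<le> norm (grad \<phi> v)"
  shows False
proof -
  let ?r = "\<lambda>g h. \<forall>p\<in>K. \<delta> / 2 * norm (g p - h p) \<le> peak g - peak h"
  have c': "c \<le> peak g" if "g \<in> deformations" for g
    using c[OF that] by simp
  have p0: "(0, \<lambda>_. 0) \<in> K"
    using zero_in_coord_ball by (simp add: K_def)
  have "\<exists>g\<in>deformations. \<forall>h\<in>deformations. ?r g h \<longrightarrow> peak h = peak g"
  proof (rule brezis_browder[where L=c, OF zero_in_deformations])
    fix g h h' :: "real \<times> (nat \<Rightarrow> real) \<Rightarrow> 'a" assume 1: "?r g h" "?r h h'"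
    show "?r g h'"
    proof
      fix p assume p: "p \<in> K"
      have "norm (g p - h' p) \<le> norm (g p - h p) + norm (h p - h' p)"
        using norm_triangle_ineq[of "g p - h p" "h p - h' p"] by simp
      then have "\<delta> / 2 * norm (g p - h' p) \<le> \<delta> / 2 * (norm (g p - h p) + norm (h p - h' p))"
        using \<delta> by (intro mult_left_mono) auto
      then show "\<delta> / 2 * norm (g p - h' p) \<le> peak g - peak h'"
        using 1[THEN bspec, OF p] unfolding distrib_left by linarith
    qed
  next
    fix g h :: "real \<times> (nat \<Rightarrow> real) \<Rightarrow> 'a" assume "?r g h"
    then have "\<delta> / 2 * norm (g (0, \<lambda>_. 0) - h (0, \<lambda>_. 0)) \<le> peak g - peak h"
      using p0 by blast
    moreover have "0 \<le> \<delta> / 2 * norm (g (0, \<lambda>_. 0) - h (0, \<lambda>_. 0))"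
      using \<delta> by simp
    ultimately show "peak h \<le> peak g"
      by linarith
  next
    fix f :: "nat \<Rightarrow> real \<times> (nat \<Rightarrow> real) \<Rightarrow> 'a"
    assume "\<And>n. f n \<in> deformations" "\<And>n. ?r (f n) (f (Suc n))"
    then show "\<exists>l\<in>deformations. \<forall>n. ?r (f n) l"
      using \<delta> c' by (intro deformations_chain_limit[where c=c]) auto
  qed (use c' in auto)
  then obtain g where g: "g \<in> deformations" "\<And>h. h \<in> deformations \<Longrightarrow> ?r g h \<Longrightarrow> peak h = peak g"
    by blast
  then show False
    using lower_peak[OF g(1) \<delta> c[OF g(1)] slope] by fastforce
qed

end

section \<open>Intersection\<close>

text \<open>On a finite-dimensional span, sigma-continuity is ordinary continuity, and equivariance
  under the identity and its negative follows from oddness. Thus admissibility supplies the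
  Borsuk-Ulam zero.\<close>

lemma borsuk_of_admissible:
  fixes b :: "nat \<Rightarrow> 'a::{real_inner, complete_space}"
  assumes act: "\<And>g. g \<in> carrier G \<Longrightarrow> act g = (\<lambda>u. u) \<or> act g = uminus"
    and b: "total_orthonormal (span (b ` {..<m})) {..<m} b"
    and adm: "admissible_action G act (span (b ` {..<m})) {..<m} b"
    and U: "openin (top_of_set (span (b ` {..<m}))) U" "bounded U" "0 \<in> U" "\<And>u. u \<in> U \<Longrightarrow> - u \<in> U"
    and W: "subspace W" "W \<subset> span (b ` {..<m})"
    and f: "continuous_on (closure U) f" "f ` closure U \<subseteq> W" "\<And>u. u \<in> closure U \<Longrightarrow> f (- u) = - f u"
  shows "\<exists>u \<in> top_of_set (span (b ` {..<m})) frontier_of U. f u = 0"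
proof -
  define E where "E = span (b ` {..<m})"
  have E: "total_orthonormal E {..<m} b"
    using b by (simp add: E_def)
  interpret orthonormal_family E "{..<m}" b
    using E by unfold_locales
  have sigma: "sigma_topology E {..<m} b = top_of_set E"
    by (rule sigma_topology_finite[OF E])
  have UE: "U \<subseteq> E" "closure U \<subseteq> E"
    using openin_imp_subset[OF U(1)] closure_minimal[OF _ closed_H] by (auto simp: E_def)
  have "invariant_set G act U"
    unfolding invariant_set_def
  proof
    fix g assume "g \<in> carrier G"
    then consider "act g = (\<lambda>u. u)" | "act g = uminus"
      using act by blast
    then show "act g ` U = U"
    proof cases
      case 2
      show ?thesis
        unfolding 2
      proof
        show "U \<subseteq> uminus ` U"
          using U(4) by (metis image_eqI minus_minus subsetI)
      qed (use U(4) in blast)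
    qed simp
  qed
  moreover have "closedin (sigma_topology E {..<m} b) (closure U)"
    unfolding sigma using UE(2) by (simp add: closed_subset)
  moreover have "sigma_admissible E {..<m} b U f"
    unfolding sigma_admissible_def sigma
  proof (intro conjI ballI)
    have "subtopology (top_of_set E) (closure U) = top_of_set (closure U)"
      using UE(2) by (simp add: subtopology_subtopology inf.absorb2)
    moreover have "f ` closure U \<subseteq> E"
      using f(2) W(2) by (auto simp: E_def)
    ultimately show "continuous_map (subtopology (top_of_set E) (closure U)) (top_of_set E) f"
      using f(1) by (auto simp: continuous_map_in_subtopology)
    fix u assume "u \<in> U"
    \<comment> \<open>The whole space \<open>E\<close> serves as neighbourhood of every point,
      because \<open>E\<close> itself is spanned by finitely many vectors.\<close>
    have "(\<lambda>x. x - f x) ` (E \<inter> U) \<subseteq> span (b ` {..<m})"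
      using closure_subset[of U] f(2) W(2) by (force intro!: span_diff simp: E_def)
    then have "\<exists>B. finite B \<and> B \<subseteq> E \<and> (\<lambda>x. x - f x) ` (E \<inter> U) \<subseteq> span B"
      using b_in_H by (intro exI[where x="b ` {..<m}"]) auto
    then show "\<exists>N. openin (top_of_set E) N \<and> u \<in> N \<and>
        (\<exists>B. finite B \<and> B \<subseteq> E \<and> (\<lambda>x. x - f x) ` (N \<inter> U) \<subseteq> span B)"
      using \<open>u \<in> U\<close> UE(1) by (intro exI[where x=E]) auto
  qed
  moreover have "equivariant_on G act (closure U) f"
    unfolding equivariant_on_def using act f(3) by (metis (full_types))
  ultimately show ?thesis
    using adm[unfolded admissible_action_def, THEN conjunct2, THEN spec, THEN spec, THEN spec,
        THEN mp, of U W f] U(1-3) W f(2)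
    by (simp only: E_def simp_thms)
qed

context orthonormal_family
begin

text \<open>Among the vectors of \<open>b\<close> indexed by \<open>T\<close>, \<open>w\<close>
  meets at most \<open>b 0\<close>; the identity holds on these vectors and extends to their closed
  span. It expresses the squared norms in \<open>peak_gt\<close> through convergent
  quantities.\<close>

lemma inner_of_orthogonal_tail:
  assumes "0 \<in> I" "T \<subseteq> I" "\<And>j. j \<in> T \<Longrightarrow> j \<noteq> 0 \<Longrightarrow> w \<bullet> b j = 0" and v: "v \<in> closure (span (b ` T))"
  shows "w \<bullet> v = (w \<bullet> b 0) * (v \<bullet> b 0)"
proof -
  let ?S = "{v. w \<bullet> v = (w \<bullet> b 0) * (v \<bullet> b 0)}"
  have "b j \<in> ?S" if "j \<in> T" for j
    using assms(3)[OF that] inner_b[of j 0] subsetD[OF assms(2) that] assms(1) by auto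
  then have "span (b ` T) \<subseteq> ?S"
    by (intro span_minimal) (auto simp: subspace_def inner_simps algebra_simps)
  then have "closure (span (b ` T)) \<subseteq> ?S"
    by (intro closure_minimal closed_Collect_eq continuous_intros)
  then show ?thesis
    using v by blast
qed

end

section \<open>Galerkin approximation and its limit\<close>

context deformation_setting
begin

text \<open>The odd map that forgets the \<open>b 0\<close> component of the moved point has a zero
  on the boundary of \<open>U\<close>. Near the sphere of radius \<open>R\<close> the time is run
  down to 0, so that this sphere contributes no boundary zero and the moved point must have norm
  \<open>r\<close>.\<close>

lemma galerkin_intersection:
  assumes g: "g \<in> deformations" and I0: "0 \<in> I" and r: "0 < r" "r < R"
    and act: "\<And>g. g \<in> carrier G \<Longrightarrow> act g = (\<lambda>u. u) \<or> act g = uminus"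
    and adm: "\<And>m. total_orthonormal (span (b ` {..<m})) {..<m} b \<Longrightarrow>
      admissible_action G act (span (b ` {..<m})) {..<m} b"
  shows "\<exists>p\<in>K. series b (snd p) \<in> span (b ` ({..<Suc n} \<inter> I)) \<and> norm (move g p) = r \<and>
    fst p = min 1 (real (Suc n) * (R - norm (series b (snd p)))) \<and>
    (\<forall>j\<in>I. j \<noteq> 0 \<longrightarrow> j < Suc n \<longrightarrow> move g p \<bullet> b j = 0)"
proof -
  obtain m where m: "{..<Suc n} \<inter> I = {..<m}"
    and tot: "total_orthonormal (span (b ` {..<m})) {..<m} b"
    using total_orthonormal_initial[of "Suc n"] by metis
  have m0: "0 < m"
    using m I0 by (metis IntI lessThan_iff zero_less_Suc)
  have sub: "{..<m} \<subseteq> I"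
    using m by blast
  define E where "E = span (b ` {..<m})"
  interpret E: orthonormal_family E "{..<m}" b
    using tot unfolding E_def by unfold_locales
  have EH: "E \<subseteq> H"
    unfolding E_def using span_mono[OF image_mono[OF sub]] span_subset_H by blast
  \<comment> \<open>The time is 1 except in a shell of width \<open>1 / Suc n\<close> below radius
    \<open>R\<close>, where it falls linearly to 0.\<close>
  define q where "q u = (min 1 (real (Suc n) * (R - norm u)), coords I b u)" for u
  define A where "A = E \<inter> cball 0 R"
  have qK: "q u \<in> K" if "u \<in> A" for u
    using that coords_in_coord_ball[of u R] by (auto simp: A_def q_def K_def)
  have contq: "continuous_on A q"
    unfolding q_def by (intro continuous_intros continuous_on_coords)
  define h where "h u = u - g (q u)" for u
  have move_q: "move g (q u) = h u" "series b (snd (q u)) = u" if "u \<in> E" for u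
    using series_coords[of u] EH that by (auto simp: move_def h_def q_def)
  have "continuous_on A (\<lambda>u. g (q u))"
    using g qK by (intro continuous_on_compose2[OF _ contq]) (auto simp: deformations_def)
  then have conth: "continuous_on A h"
    unfolding h_def by (intro continuous_intros)
  have A_minus: "- u \<in> A" if "u \<in> A" for u
    using that by (simp add: A_def E.subspace_H subspace_neg)
  have h_minus: "h (- u) = - h u" if "u \<in> A" for u
  proof -
    have "q (- u) = flip (q u)"
      by (simp add: q_def flip_def coords_uminus)
    then show ?thesis
      using g qK[OF that] by (simp add: h_def deformations_def)
  qed
  define A' where "A' = E \<inter> ball 0 R"
  have A': "A' \<subseteq> A"
    by (auto simp: A'_def A_def)
  define U where "U = A' \<inter> h -` ball 0 r"
  have U_iff: "u \<in> U \<longleftrightarrow> u \<in> E \<and> norm u < R \<and> norm (h u) < r" for u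
    by (auto simp: U_def A'_def)
  have "openin (top_of_set A') U"
    unfolding U_def by (intro continuous_openin_preimage_gen continuous_on_subset[OF conth A']) simp
  moreover have "openin (top_of_set E) A'"
    unfolding A'_def by (simp add: openin_open_Int)
  ultimately have openU: "openin (top_of_set E) U"
    by (rule openin_trans)
  have "closed A"
    unfolding A_def by (intro closed_Int E.closed_H closed_cball)
  then have "closed (A \<inter> h -` cball 0 r)"
    by (intro continuous_closed_preimage conth closed_cball)
  moreover have "U \<subseteq> A \<inter> h -` cball 0 r"
    using A' by (auto simp: U_def)
  ultimately have closureU: "closure U \<subseteq> A \<inter> h -` cball 0 r"
    by (rule closure_minimal[rotated])
  \<comment> \<open>Oddness forces the correction at the origin to vanish, so the origin belongs to
    \<open>U\<close>.\<close>
  have "q 0 \<in> K" "flip (q 0) = q 0"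
    using qK[of 0] R_pos E.subspace_H by (auto simp: A_def subspace_0 q_def flip_def coords_def)
  then have "g (q 0) = - g (q 0)"
    using g by (force simp: deformations_def)
  then have "h 0 = 0"
    by (simp add: h_def eq_neg_iff_add_eq_0 scaleR_2[symmetric])
  then have U0: "0 \<in> U"
    using R_pos r by (simp add: U_iff E.subspace_H subspace_0)
  \<comment> \<open>Omitting the coordinate 0 puts the values into a proper subspace, as
    admissibility requires.\<close>
  define f where "f u = (\<Sum>j\<in>{1..<m}. (h u \<bullet> b j) *\<^sub>R b j)" for u
  define W where "W = span (b ` {1..<m})"
  have "b 0 \<notin> W"
  proof
    assume "b 0 \<in> W"
    moreover have "W \<subseteq> {v. b 0 \<bullet> v = 0}"
      unfolding W_def using E.inner_b m0
      by (intro span_minimal) (auto simp: subspace_def inner_simps)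
    ultimately show False
      using E.norm_b[of 0] m0 by auto
  qed
  moreover have "b 0 \<in> E" "W \<subseteq> E"
    unfolding E_def W_def using m0 by (auto intro!: span_base span_mono image_mono)
  ultimately have W: "W \<subset> E"
    by blast
  have "\<exists>u \<in> top_of_set E frontier_of U. f u = 0"
    unfolding E_def
  proof (rule borsuk_of_admissible[where G=G and act=act and W=W])
    show "bounded U"
      by (rule bounded_subset[of "ball 0 R"]) (auto simp: U_iff)
    show "- u \<in> U" if "u \<in> U" for u
      using that h_minus[of u] by (auto simp: U_iff A_def E.subspace_H subspace_neg)
    show "subspace W"
      by (simp add: W_def)
    show "continuous_on (closure U) f"
      unfolding f_def using closureU by (intro continuous_intros continuous_on_subset[OF conth]) auto
    show "f ` closure U \<subseteq> W"
      unfolding f_def W_def by (intro image_subsetI span_sum span_scale span_base imageI)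
    show "f (- u) = - f u" if "u \<in> closure U" for u
      using h_minus[of u] closureU that by (auto simp: f_def sum_negf)
  qed (use act tot adm openU U0 W in \<open>auto simp: E_def\<close>)
  then obtain u where u: "u \<in> top_of_set E frontier_of U" "f u = 0"
    by blast
  have "u \<in> closure U"
    using u(1) closure_of_subtopology_subset[of euclidean E U] by (auto simp: frontier_of_def)
  then have uA: "u \<in> A" "norm (h u) \<le> r"
    using closureU by auto
  have "u \<notin> U"
    using u(1) openU by (simp add: frontier_of_def interior_of_openin)
  have uE: "u \<in> E"
    using uA by (simp add: A_def)
  \<comment> \<open>At radius \<open>R\<close> the time is 0 and \<open>h u = u\<close>,
    contradicting \<open>norm (h u) \<le> r\<close> and \<open>r < R\<close>.\<close>
  have "norm u \<noteq> R"
  proof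
    assume "norm u = R"
    then have "fst (q u) = 0"
      by (simp add: q_def)
    then have "g (q u) = 0"
      using g qK[OF uA(1)] by (simp add: deformations_def)
    then show False
      using uA(2) r \<open>norm u = R\<close> by (simp add: h_def)
  qed
  then have "norm (h u) = r"
    using uA \<open>u \<notin> U\<close> by (auto simp: U_iff A_def)
  moreover have "h u \<bullet> b j = 0" if "j \<in> I" "j \<noteq> 0" "j < Suc n" for j
  proof -
    have j: "j \<in> {1..<m}"
      using that m by (metis IntI One_nat_def Suc_leI atLeastLessThan_iff lessThan_iff neq0_conv)
    have "0 = f u \<bullet> b j"
      using u(2) by simp
    also have "\<dots> = (\<Sum>i\<in>{1..<m}. if i = j then h u \<bullet> b j else 0)"
      unfolding f_def inner_sum_left using E.inner_b j by (intro sum.cong) auto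
    also have "\<dots> = h u \<bullet> b j"
      using j by simp
    finally show ?thesis
      by simp
  qed
  ultimately show ?thesis
    using qK[OF uA(1)] move_q[OF uE] uE
    by (intro bexI[where x="q u"]) (auto simp: m E_def q_def)
qed

text \<open>A subsequence of the Galerkin solutions converges in \<open>K\<close>, hence weakly as
  vectors. Norm convergence is then recovered, so the limit retains norm \<open>r\<close> after
  moving, and its time turns out to be 1.\<close>

lemma peak_gt:
  assumes g: "g \<in> deformations" and I0: "0 \<in> I" and r: "0 < r" "r < R"
    and act: "\<And>g. g \<in> carrier G \<Longrightarrow> act g = (\<lambda>u. u) \<or> act g = uminus"
    and adm: "\<And>m. total_orthonormal (span (b ` {..<m})) {..<m} b \<Longrightarrow>
      admissible_action G act (span (b ` {..<m})) {..<m} b"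
    and boundary: "\<And>u. u \<in> H \<Longrightarrow> norm u = R \<Longrightarrow> \<phi> u \<le> c"
    and sphere: "\<And>w. (\<And>j. j \<in> I \<Longrightarrow> j \<noteq> 0 \<Longrightarrow> w \<bullet> b j = 0) \<Longrightarrow> norm w = r \<Longrightarrow> c < \<phi> w"
  shows "c < peak g"
proof -
  have "\<forall>n. \<exists>p\<in>K. series b (snd p) \<in> span (b ` ({..<Suc n} \<inter> I)) \<and> norm (move g p) = r \<and>
      fst p = min 1 (real (Suc n) * (R - norm (series b (snd p)))) \<and>
      (\<forall>j\<in>I. j \<noteq> 0 \<longrightarrow> j < Suc n \<longrightarrow> move g p \<bullet> b j = 0)"
    using galerkin_intersection[OF g I0 r act adm] by blast
  then obtain p where p: "\<And>n. p n \<in> K" "\<And>n. series b (snd (p n)) \<in> span (b ` ({..<Suc n} \<inter> I))"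
    "\<And>n. norm (move g (p n)) = r"
    "\<And>n. fst (p n) = min 1 (real (Suc n) * (R - norm (series b (snd (p n)))))"
    "\<And>n j. j \<in> I \<Longrightarrow> j \<noteq> 0 \<Longrightarrow> j < Suc n \<Longrightarrow> move g (p n) \<bullet> b j = 0"
    by metis
  obtain l \<sigma> where l: "l \<in> K" "strict_mono \<sigma>" "(p \<circ> \<sigma>) \<longlonglongrightarrow> l"
    using seq_compactE[OF compact_imp_seq_compact[OF compact_K], of p] p(1) by blast
  define q where "q n = p (\<sigma> n)" for n
  have q: "\<And>n. q n \<in> K" "q \<longlonglongrightarrow> l"
  proof -
    have "q = p \<circ> \<sigma>"
      by (auto simp: q_def)
    then show "q \<longlonglongrightarrow> l"
      using l(3) by simp
  qed (simp add: q_def p(1))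
  define u where "u n = series b (snd (q n))" for n
  define v where "v = series b (snd l)"
  have norm_u: "norm (u n) \<le> R" for n
    unfolding u_def using norm_series_le[OF snd_in_coord_ball[OF q(1)]] R_pos by simp
  have v: "v \<in> H" "norm v \<le> R"
    unfolding v_def using norm_series_le series_in_H snd_in_coord_ball[OF l(1)] R_pos by auto
  have u_weak: "weak_lim u v"
    unfolding u_def v_def using q l(1) R_pos
    by (intro series_weak_lim[where R=R] snd_in_coord_ball tendsto_snd) auto
  have move_weak: "weak_lim (\<lambda>n. move g (q n)) (move g l)"
    by (rule move_weak_lim[OF g q(1) l(1) q(2)])
  have g_lim: "(\<lambda>n. g (q n)) \<longlonglongrightarrow> g l"
    by (rule deformation_LIMSEQ[OF g q(1) l(1) q(2)])
  have move_l: "move g l \<bullet> b j = 0" if "j \<in> I" "j \<noteq> 0" for j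
  proof -
    have "\<forall>\<^sub>F n in sequentially. move g (q n) \<bullet> b j = 0"
      using eventually_ge_at_top[of j]
    proof eventually_elim
      case (elim n)
      then have "j < Suc (\<sigma> n)"
        using seq_suble[OF l(2), of n] by simp
      then show ?case
        unfolding q_def by (rule p(5)[OF that])
    qed
    then have "(\<lambda>n. move g (q n) \<bullet> b j) \<longlonglongrightarrow> 0"
      by (rule tendsto_eventually)
    then show ?thesis
      using move_weak unfolding weak_lim_def by (blast intro: LIMSEQ_unique)
  qed
  \<comment> \<open>The Galerkin equations give \<open>norm (u n)\<close> squared as
    \<open>u n \<bullet> g (q n)\<close> plus a product of two coordinates along \<open>b 0\<close>.
    Both terms converge, since \<open>g (q n)\<close> converges in norm, and the limit satisfies the
    same identity.\<close>
  have "u \<longlonglongrightarrow> v"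
  proof (rule weak_lim_norm_tendsto[OF u_weak])
    have "move g (q n) \<bullet> u n = (move g (q n) \<bullet> b 0) * (u n \<bullet> b 0)" for n
      using p(2)[of "\<sigma> n"] p(5)[of _ "\<sigma> n"] closure_subset
      by (intro inner_of_orthogonal_tail[OF I0, of "{..<Suc (\<sigma> n)} \<inter> I"]) (auto simp: q_def u_def)
    moreover have "move g (q n) \<bullet> u n = (norm (u n))\<^sup>2 - u n \<bullet> g (q n)" for n
      by (simp add: move_def u_def power2_norm_eq_inner inner_diff_left inner_diff_right inner_commute)
    ultimately have *: "(norm (u n))\<^sup>2 = u n \<bullet> g (q n) + (move g (q n) \<bullet> b 0) * (u n \<bullet> b 0)" for n
      by (metis add_diff_cancel_left' diff_eq_eq add.commute)
    have "(\<lambda>n. u n \<bullet> g (q n) + (move g (q n) \<bullet> b 0) * (u n \<bullet> b 0)) \<longlonglongrightarrow>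
        v \<bullet> g l + (move g l \<bullet> b 0) * (v \<bullet> b 0)"
      using u_weak move_weak
      by (intro tendsto_add tendsto_mult weak_lim_inner_tendsto[OF u_weak g_lim norm_u])
        (auto simp: weak_lim_def)
    moreover have "move g l \<bullet> v = (move g l \<bullet> b 0) * (v \<bullet> b 0)"
      using v(1) move_l by (intro inner_of_orthogonal_tail[OF I0, of I]) (auto simp: H_eq)
    moreover have "move g l \<bullet> v = (norm v)\<^sup>2 - v \<bullet> g l"
      by (simp add: move_def v_def power2_norm_eq_inner inner_diff_left inner_diff_right inner_commute)
    ultimately show "(\<lambda>n. (norm (u n))\<^sup>2) \<longlonglongrightarrow> (norm v)\<^sup>2"
      by (simp add: * algebra_simps)
  qed
  then have "(\<lambda>n. norm (move g (q n))) \<longlonglongrightarrow> norm (move g l)"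
    unfolding move_def u_def[symmetric] v_def[symmetric] by (intro tendsto_intros g_lim)
  then have "norm (move g l) = r"
    using p(3) by (simp add: q_def LIMSEQ_const_iff)
  then have c: "c < \<phi> (move g l)"
    by (intro sphere move_l)
  also have "\<dots> \<le> \<phi> v"
    using g l(1) by (simp add: deformations_def v_def)
  \<comment> \<open>On the sphere of radius \<open>R\<close> the height of \<open>v\<close> would be
    at most \<open>c\<close>, although the lower moved point is already above
    \<open>c\<close>.\<close>
  finally have "norm v \<noteq> R"
    using boundary[OF v(1)] by force
  then have less: "norm v < R"
    using v(2) by simp
  have "\<forall>\<^sub>F n in sequentially. fst (q n) = 1"
  proof -
    \<comment> \<open>Eventually the norms stay \<open>(R - norm v) / 2\<close> below
      \<open>R\<close>, so the growing factor \<open>Suc (\<sigma> n)\<close> makes the minimum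
      defining the time equal to 1.\<close>
    have "norm v < (R + norm v) / 2"
      using less by simp
    then have "\<forall>\<^sub>F n in sequentially. norm (u n) < (R + norm v) / 2"
      by (rule order_tendstoD(2)[OF tendsto_norm[OF \<open>u \<longlonglongrightarrow> v\<close>]])
    then show ?thesis
      using eventually_ge_at_top[of "nat \<lceil>2 / (R - norm v)\<rceil>"]
    proof eventually_elim
      case (elim n)
      have "2 / (R - norm v) \<le> real n"
        using elim(2) by (simp add: nat_le_iff ceiling_le_iff)
      also have "\<dots> \<le> real (Suc (\<sigma> n))"
        using seq_suble[OF l(2), of n] by simp
      finally have "1 \<le> real (Suc (\<sigma> n)) * ((R - norm v) / 2)"
        using less by (simp add: field_simps)
      also have "\<dots> \<le> real (Suc (\<sigma> n)) * (R - norm (u n))"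
        using elim(1) by (intro mult_left_mono) (auto simp: field_simps)
      finally show ?case
        using p(4)[of "\<sigma> n"] by (simp add: q_def u_def)
    qed
  qed
  then have "fst l = 1"
    using LIMSEQ_unique[OF tendsto_fst[OF q(2)] tendsto_eventually] by blast
  then have "l = (1, snd l)"
    by (metis prod.collapse)
  then show ?thesis
    using c move_le_peak[OF g snd_in_coord_ball[OF l(1)]] by simp
qed

end

section \<open>The fountain setting\<close>

text \<open>Each vector is kept or negated. If \<open>u\<close> were negated and \<open>v\<close>
  kept, both nonzero, then \<open>u + v\<close> would be neither kept nor negated.\<close>

lemma isometry_preserving_lines:
  fixes A :: "'a::real_inner \<Rightarrow> 'a"
  assumes A: "linear A" "\<And>u. norm (A u) = norm u"
    and lines: "\<And>u. A u \<in> span {u}"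
  shows "A = (\<lambda>u. u) \<or> A = uminus"
proof -
  interpret linear A
    by fact
  have pm: "A u = u \<or> A u = - u" for u
  proof -
    obtain c where c: "A u = c *\<^sub>R u"
      using lines[of u] by (auto simp: span_singleton)
    then have "\<bar>c\<bar> * norm u = norm u"
      using A(2)[of u] by simp
    then show ?thesis
      using c by (cases "u = 0") (auto simp: abs_if split: if_splits)
  qed
  show ?thesis
  proof (rule ccontr)
    assume "\<not> ?thesis"
    then obtain u v where uv: "A u \<noteq> u" "A v \<noteq> - v"
      by (metis ext)
    then have A: "A u = - u" "A v = v"
      using pm by blast+
    have double: "x = 0" if "x + x = 0" for x :: 'a
      using that by (simp add: scaleR_2[symmetric])
    from pm[of "u + v"] have "u = 0 \<or> v = 0"
      using double[of u] double[of v] by (auto simp: add A algebra_simps)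
    then show False
      using uv A by auto
  qed
qed

text \<open>Makes the hypotheses on closed subspaces applicable to lines. For
  \<open>u \<noteq> 0\<close> a line is the solution set of a continuous equation.\<close>

lemma closed_span_singleton:
  fixes u :: "'a::real_inner"
  shows "closed (span {u})"
proof -
  have "v \<in> span {u}" if "(u \<bullet> u) *\<^sub>R v = (v \<bullet> u) *\<^sub>R u" "u \<noteq> 0" for v
  proof -
    have "v = (v \<bullet> u / (u \<bullet> u)) *\<^sub>R u"
      using that by (metis inner_eq_zero_iff scaleR_left_imp_eq divide_inverse_commute scaleR_scaleR
          right_inverse scaleR_one)
    then show ?thesis
      by (metis span_base span_scale singletonI)
  qed
  then have "span {u} = (if u = 0 then {0} else {v. (u \<bullet> u) *\<^sub>R v = (v \<bullet> u) *\<^sub>R u})"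
    by (auto simp: span_singleton)
  moreover have "closed {v. (u \<bullet> u) *\<^sub>R v = (v \<bullet> u) *\<^sub>R u}"
    by (intro closed_Collect_eq continuous_intros)
  ultimately show ?thesis
    by simp
qed

text \<open>Gradients tending to zero at heights in \<open>{B..d}\<close> give, after passing to a
  subsequence of convergent heights, a Palais-Smale sequence; a cluster point would be critical at a
  level of at least \<open>B\<close>.\<close>

lemma gradient_bound_of_palais_smale:
  fixes \<phi> :: "'a::{real_inner, complete_space} \<Rightarrow> real"
  assumes C1: "C1 \<phi>" and PS: "\<And>c. B \<le> c \<Longrightarrow> palais_smale \<phi> c"
    and regular: "\<And>c. B \<le> c \<Longrightarrow> \<not> critical_value \<phi> c"
  shows "\<exists>\<delta>>0. \<forall>v. B \<le> \<phi> v \<longrightarrow> \<phi> v \<le> d \<longrightarrow> \<delta> \<le> norm (grad \<phi> v)"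
proof (rule ccontr)
  assume contra: "\<not> ?thesis"
  have diff: "\<phi> differentiable (at u)" for u
    using C1 by (simp add: C1_def)
  have "\<exists>v. B \<le> \<phi> v \<and> \<phi> v \<le> d \<and> norm (fderiv \<phi> v) \<le> inverse (real (Suc n))" for n
  proof -
    have "inverse (real (Suc n)) > 0"
      by simp
    then obtain v where "B \<le> \<phi> v" "\<phi> v \<le> d" "norm (grad \<phi> v) < inverse (real (Suc n))"
      using contra by (meson not_le)
    then show ?thesis
      using norm_fderiv_le_grad[OF diff, of v] by (intro exI[where x=v]) simp
  qed
  then obtain v where v: "\<And>n. \<phi> (v n) \<in> {B..d}" "\<And>n. norm (fderiv \<phi> (v n)) \<le> inverse (real (Suc n))"
    by (metis atLeastAtMost_iff)
  have deriv: "(\<lambda>n. fderiv \<phi> (v n)) \<longlonglongrightarrow> 0"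
    using v(2) by (intro Lim_null_comparison[OF _ LIMSEQ_inverse_real_of_nat]) auto
  obtain c \<sigma> where c: "c \<in> {B..d}" "strict_mono \<sigma>" "((\<lambda>n. \<phi> (v n)) \<circ> \<sigma>) \<longlonglongrightarrow> c"
    using seq_compactE[OF compact_imp_seq_compact[OF compact_Icc], of "\<lambda>n. \<phi> (v n)"] v(1) by blast
  have deriv\<sigma>: "(\<lambda>n. fderiv \<phi> (v (\<sigma> n))) \<longlonglongrightarrow> 0"
    using LIMSEQ_subseq_LIMSEQ[OF deriv c(2)] by (simp add: o_def)
  have "palais_smale \<phi> c"
    using PS c(1) by simp
  then obtain s where s: "strict_mono s" "convergent ((\<lambda>n. v (\<sigma> n)) \<circ> s)"
    using c(3) deriv\<sigma> unfolding palais_smale_def o_def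
    by (elim allE[where x="\<lambda>n. v (\<sigma> n)"]) blast
  then obtain l where l: "(\<lambda>n. v (\<sigma> (s n))) \<longlonglongrightarrow> l"
    by (auto simp: convergent_def o_def)
  have "(\<lambda>n. \<phi> (v (\<sigma> (s n)))) \<longlonglongrightarrow> \<phi> l"
    by (rule isCont_tendsto_compose[OF differentiable_imp_continuous_within[OF diff] l])
  moreover have "(\<lambda>n. \<phi> (v (\<sigma> (s n)))) \<longlonglongrightarrow> c"
    using LIMSEQ_subseq_LIMSEQ[OF c(3) s(1)] by (simp add: o_def)
  ultimately have "\<phi> l = c"
    by (rule LIMSEQ_unique)
  have "(\<lambda>n. fderiv \<phi> (v (\<sigma> (s n)))) \<longlonglongrightarrow> fderiv \<phi> l"
    using C1 by (intro continuous_on_tendsto_compose[OF _ l]) (auto simp: C1_def)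
  moreover have "(\<lambda>n. fderiv \<phi> (v (\<sigma> (s n)))) \<longlonglongrightarrow> 0"
    using LIMSEQ_subseq_LIMSEQ[OF deriv\<sigma> s(1)] by (simp add: o_def)
  ultimately have "fderiv \<phi> l = 0"
    by (rule LIMSEQ_unique)
  then have "critical_value \<phi> c"
    using \<open>\<phi> l = c\<close> by (auto simp: critical_value_def)
  then show False
    using regular c(1) by simp
qed

text \<open>
  The vector \<open>e k\<close>, which distinguishes \<open>Yk Y e k\<close> from \<open>Yk Y e (k - 1)\<close>, comes first.
\<close>

definition yk_basis :: "(nat \<Rightarrow> 'a) \<Rightarrow> (nat \<Rightarrow> 'a) \<Rightarrow> nat \<Rightarrow> nat \<Rightarrow> 'a" where
  "yk_basis e \<theta> k j = (if j = 0 then e k else if j \<le> k then e (j - 1) else \<theta> (j - Suc k))"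

text \<open>The first \<open>Suc k\<close> positions hold vectors of \<open>e\<close>, and
  \<open>J\<close> follows shifted by \<open>Suc k\<close>, so that the result is again an initial
  segment.\<close>

definition yk_index :: "nat set \<Rightarrow> nat \<Rightarrow> nat set" where
  "yk_index J k = {j. j \<le> k \<or> j - Suc k \<in> J}"

section \<open>Coordinates on \<open>Yk\<close> and its linking with \<open>Zk\<close>\<close>

locale fountain_space =
  fixes Y :: "'a::{real_inner, complete_space} set" and e \<theta> :: "nat \<Rightarrow> 'a" and J :: "nat set"
  assumes Y: "subspace Y" "closed Y"
    and e: "total_orthonormal (orthogonal_comp Y) UNIV e"
    and \<theta>: "total_orthonormal Y J \<theta>"
begin

sublocale E: orthonormal_family "orthogonal_comp Y" UNIV e
  using e by unfold_locales

sublocale T: orthonormal_family Y J \<theta>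
  using \<theta> by unfold_locales

lemma inner_Y_e: "y \<in> Y \<Longrightarrow> y \<bullet> e i = 0"
  using E.b_in_H[of i] by (simp add: orthogonal_comp_def orthogonal_def)

lemma inner_e: "e i \<bullet> e j = (if i = j then 1 else 0)"
  by (simp add: E.inner_b)

text \<open>The projection onto the span of the first \<open>n\<close> vectors of \<open>e\<close>;
  as a finite sum of inner products it turns weak into norm convergence.\<close>

definition head :: "nat \<Rightarrow> 'a \<Rightarrow> 'a" where
  "head n u = (\<Sum>i<n. (u \<bullet> e i) *\<^sub>R e i)"

lemma linear_head: "linear (head n)"
  unfolding head_def
  by (intro linearI) (simp_all add: inner_simps scaleR_add_left sum.distrib scaleR_sum_right)

lemma head_e: "head n (e i) = (if i < n then e i else 0)"
proof -
  have "head n (e i) = (\<Sum>j<n. if j = i then e i else 0)"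
    unfolding head_def inner_e by (intro sum.cong) auto
  then show ?thesis
    by simp
qed

lemma head_span:
  assumes "z \<in> span (e ` {..<n})"
  shows "head n z = z"
  using assms
proof (induction rule: span_induct_alt)
  case (step c x y)
  then show ?case
    by (auto simp: linear_add[OF linear_head] linear_scale[OF linear_head] head_e)
qed (rule linear_0[OF linear_head])

lemma head_Y: "y \<in> Y \<Longrightarrow> head n y = 0"
  by (simp add: head_def inner_Y_e)

lemma head_in_span: "head n u \<in> span (e ` {..<n})"
  unfolding head_def by (intro span_sum span_scale span_base) auto

lemma continuous_on_head: "continuous_on S (head n)"
  unfolding head_def by (intro continuous_intros)

text \<open>Exhibits \<open>Yk\<close> as the preimage of \<open>Y\<close> under a continuous linear
  map, from which it inherits being a closed subspace.\<close>

lemma Yk_iff: "u \<in> Yk Y e k \<longleftrightarrow> u - head (Suc k) u \<in> Y"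
proof
  assume "u \<in> Yk Y e k"
  then obtain y z where "u = y + z" "y \<in> Y" "z \<in> span (e ` {..<Suc k})"
    by (auto simp: Yk_def atLeast0AtMost lessThan_Suc_atMost)
  then show "u - head (Suc k) u \<in> Y"
    by (simp add: linear_add[OF linear_head] head_Y head_span)
next
  assume "u - head (Suc k) u \<in> Y"
  then show "u \<in> Yk Y e k"
    using head_in_span[of "Suc k" u]
    unfolding Yk_def atLeast0AtMost lessThan_Suc_atMost[symmetric]
    by (intro CollectI exI[where x="u - head (Suc k) u"] exI[where x="head (Suc k) u"]) simp
qed

lemma orth_proj_Yk:
  assumes "u \<in> Yk Y e k"
  shows "orth_proj Y u = u - head (Suc k) u"
proof (rule orth_proj_unique[OF Y(1)])
  have "head (Suc k) u \<in> orthogonal_comp Y"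
    unfolding head_def
    by (intro subspace_sum subspace_scale subspace_orthogonal_comp E.b_in_H) auto
  then show "u - (u - head (Suc k) u) \<in> orthogonal_comp Y"
    by simp
qed (use assms Yk_iff in blast)

lemma total_orthonormal_Yk: "total_orthonormal (Yk Y e k) (yk_index J k) (yk_basis e \<theta> k)"
  unfolding total_orthonormal_def
proof (intro conjI ballI)
  consider "J = UNIV" | n where "J = {..<n}"
    using \<theta> unfolding total_orthonormal_def by blast
  then show "yk_index J k = UNIV \<or> (\<exists>n. yk_index J k = {..<n})"
  proof cases
    case 2
    then show ?thesis
      by (intro disjI2 exI[where x="Suc k + n"]) (auto simp: yk_index_def)
  qed (simp add: yk_index_def)
  show "yk_basis e \<theta> k i \<bullet> yk_basis e \<theta> k j = (if i = j then 1 else 0)"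
    if "i \<in> yk_index J k" "j \<in> yk_index J k" for i j
  proof -
    have "e i \<bullet> \<theta> j = 0" "\<theta> j \<bullet> e i = 0" if "j \<in> J" for i j
      using inner_Y_e[OF T.b_in_H[OF that], of i] by (simp_all add: inner_commute)
    then show ?thesis
      using that T.inner_b[of "i - Suc k" "j - Suc k"]
      by (auto simp: yk_index_def yk_basis_def inner_e)
  qed
  have image: "yk_basis e \<theta> k ` yk_index J k = e ` {..<Suc k} \<union> \<theta> ` J"
  proof (intro antisym Un_least subsetI)
    fix v assume "v \<in> e ` {..<Suc k}"
    then obtain i where i: "i \<le> k" "v = e i"
      by (auto simp: less_Suc_eq_le)
    show "v \<in> yk_basis e \<theta> k ` yk_index J k"
    proof (cases "i = k")
      case True
      then show ?thesis
        using i by (intro image_eqI[where x=0]) (auto simp: yk_basis_def yk_index_def)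
    next
      case False
      then show ?thesis
        using i by (intro image_eqI[where x="Suc i"]) (auto simp: yk_basis_def yk_index_def)
    qed
  next
    fix v assume "v \<in> \<theta> ` J"
    then obtain i where "i \<in> J" "v = \<theta> i"
      by blast
    then show "v \<in> yk_basis e \<theta> k ` yk_index J k"
      by (intro image_eqI[where x="Suc k + i"]) (auto simp: yk_basis_def yk_index_def)
  qed (auto simp: yk_basis_def yk_index_def)
  have closed: "closed (Yk Y e k)"
  proof -
    have "Yk Y e k = (\<lambda>u. u - head (Suc k) u) -` Y"
      using Yk_iff by blast
    then show ?thesis
      using closed_vimage[OF Y(2)] continuous_on_diff[OF continuous_on_id continuous_on_head] by metis
  qed
  have subspace: "subspace (Yk Y e k)"
    by (rule subspaceI)
      (simp_all add: Yk_iff linear_0[OF linear_head] linear_add[OF linear_head]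
        linear_scale[OF linear_head] add_diff_add scaleR_diff_right[symmetric]
        subspace_0[OF Y(1)] subspace_add[OF Y(1)] subspace_scale[OF Y(1)])
  show "closure (span (yk_basis e \<theta> k ` yk_index J k)) = Yk Y e k"
    unfolding image
  proof
    have "e ` {..<Suc k} \<union> \<theta> ` J \<subseteq> Yk Y e k"
      using T.b_in_H by (auto simp: Yk_iff head_e head_Y subspace_0[OF Y(1)] simp del: lessThan_Suc)
    then show "closure (span (e ` {..<Suc k} \<union> \<theta> ` J)) \<subseteq> Yk Y e k"
      by (intro closure_minimal span_minimal closed subspace)
    show "Yk Y e k \<subseteq> closure (span (e ` {..<Suc k} \<union> \<theta> ` J))" (is "_ \<subseteq> ?C")
    proof
      fix u assume "u \<in> Yk Y e k"
      then have "u - head (Suc k) u \<in> closure (span (\<theta> ` J))"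
        using Yk_iff T.H_eq by simp
      then have "u - head (Suc k) u \<in> ?C"
        using closure_mono[OF span_mono[of "\<theta> ` J" "e ` {..<Suc k} \<union> \<theta> ` J"]] by blast
      moreover have "head (Suc k) u \<in> ?C"
        using head_in_span[of "Suc k" u] span_mono[of "e ` {..<Suc k}" "e ` {..<Suc k} \<union> \<theta> ` J"]
          closure_subset by blast
      ultimately have "(u - head (Suc k) u) + head (Suc k) u \<in> ?C"
        by (intro subspace_add subspace_closure subspace_span)
      then show "u \<in> ?C"
        by simp
    qed
  qed
qed

text \<open>\<open>Yk\<close> and \<open>Zk\<close> share the direction \<open>e k\<close>.
  Orthogonality to the other basis vectors of \<open>Yk\<close> therefore removes \<open>Y\<close>
  and the \<open>e i\<close> with \<open>i < k\<close>, leaving exactly what generates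
  \<open>Zk\<close>.\<close>

lemma in_Zk_if_orthogonal:
  assumes w: "\<And>j. j \<in> yk_index J k \<Longrightarrow> j \<noteq> 0 \<Longrightarrow> w \<bullet> yk_basis e \<theta> k j = 0"
  shows "w \<in> Zk e k"
proof -
  have we: "w \<bullet> e i = 0" if "i < k" for i
    using w[of "Suc i"] that by (simp add: yk_basis_def yk_index_def)
  have w\<theta>: "w \<bullet> \<theta> i = 0" if "i \<in> J" for i
    using w[of "Suc k + i"] that by (simp add: yk_basis_def yk_index_def)
  have "\<theta> ` J \<subseteq> {v. w \<bullet> v = 0}"
    using w\<theta> by blast
  then have "span (\<theta> ` J) \<subseteq> {v. w \<bullet> v = 0}"
    by (rule span_minimal) (auto simp: subspace_def inner_simps)
  then have "Y \<subseteq> {v. w \<bullet> v = 0}"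
    unfolding T.H_eq by (intro closure_minimal closed_Collect_eq continuous_intros)
  then have "w \<in> orthogonal_comp Y"
    by (auto simp: orthogonal_comp_def orthogonal_def inner_commute)
  then have wY: "w \<in> closure (span (range e))"
    by (simp only: E.H_eq)
  \<comment> \<open>A closed subspace containing every \<open>e i\<close>, hence also
    \<open>w\<close>; there \<open>head k w = 0\<close> gives the claim.\<close>
  let ?S = "(\<lambda>v. v - head k v) -` Zk e k"
  have Zk: "subspace (Zk e k)" "closed (Zk e k)"
    unfolding Zk_def by (auto intro: subspace_closure)
  have ek: "e i \<in> Zk e k" if "k \<le> i" for i
    unfolding Zk_def using that by (intro subsetD[OF closure_subset] span_base) simp
  have "range e \<subseteq> ?S"
    using ek by (auto simp: head_e subspace_0[OF Zk(1)] not_less)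
  moreover have "subspace ?S"
    using Zk(1) unfolding subspace_def
    by (auto simp: linear_0[OF linear_head] linear_add[OF linear_head] linear_scale[OF linear_head]
        add_diff_add scaleR_diff_right[symmetric])
  ultimately have "span (range e) \<subseteq> ?S"
    by (rule span_minimal)
  moreover have "closed ?S"
    by (intro closed_vimage Zk continuous_on_diff continuous_on_id continuous_on_head)
  ultimately have "closure (span (range e)) \<subseteq> ?S"
    by (rule closure_minimal)
  moreover have "head k w = 0"
    by (simp add: head_def we)
  ultimately show ?thesis
    using wY by auto
qed

text \<open>The component of a vector of \<open>Yk\<close> orthogonal to \<open>Y\<close> is its
  finite \<open>head\<close>, so weak convergence is norm convergence there and
  \<open>tau_usc_sequentially\<close> applies.\<close>

lemma usc_Yk:
  assumes usc: "upper_semicontinuous (tau_topology Y J \<theta>) \<phi>" and R: "R > 0"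
    and x: "\<And>n. x n \<in> coord_ball (yk_index J k) R" "y \<in> coord_ball (yk_index J k) R" "x \<longlonglongrightarrow> y"
    and w: "w \<longlonglongrightarrow> v" and c: "\<phi> (series (yk_basis e \<theta> k) y - v) < c"
  shows "\<forall>\<^sub>F n in sequentially. \<phi> (series (yk_basis e \<theta> k) (x n) - w n) < c"
proof -
  interpret B: orthonormal_family "Yk Y e k" "yk_index J k" "yk_basis e \<theta> k"
    using total_orthonormal_Yk by unfold_locales
  let ?s = "series (yk_basis e \<theta> k)"
  have s_weak: "weak_lim (\<lambda>n. ?s (x n)) (?s y)"
    using R by (intro B.series_weak_lim[where R=R] x) simp
  obtain C where C: "\<And>n. norm (w n) \<le> C"
    using convergent_imp_bounded[OF w] by (auto simp: bounded_iff)
  show ?thesis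
  proof (rule tau_usc_sequentially[OF Y \<theta> usc _ _ _ c])
    show "weak_lim (\<lambda>n. ?s (x n) - w n) (?s y - v)"
      by (intro weak_lim_diff s_weak weak_lim_tendsto w)
    show "norm (?s (x n) - w n) \<le> R + C" for n
      using norm_triangle_ineq4[of "?s (x n)" "w n"] B.norm_series_le[OF x(1), of n] R C[of n] by linarith
    have "(\<lambda>n. head (Suc k) (?s (x n))) \<longlonglongrightarrow> head (Suc k) (?s y)"
      using s_weak unfolding head_def weak_lim_def by (intro tendsto_sum tendsto_scaleR tendsto_const) blast
    moreover have "(\<lambda>n. orth_proj Y (w n)) \<longlonglongrightarrow> orth_proj Y v"
    proof (rule metric_tendsto_imp_tendsto[OF w])
      show "\<forall>\<^sub>F n in sequentially. dist (orth_proj Y (w n)) (orth_proj Y v) \<le> dist (w n) v"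
        using norm_orth_proj_le[OF Y] by (simp add: dist_norm orth_proj_diff[OF Y, symmetric])
    qed
    ultimately have "(\<lambda>n. head (Suc k) (?s (x n)) - (w n - orth_proj Y (w n))) \<longlonglongrightarrow>
        head (Suc k) (?s y) - (v - orth_proj Y v)"
      by (intro tendsto_diff w)
    then show "(\<lambda>n. ?s (x n) - w n - orth_proj Y (?s (x n) - w n)) \<longlonglongrightarrow>
        ?s y - v - orth_proj Y (?s y - v)"
      by (simp add: orth_proj_diff[OF Y] orth_proj_Yk[OF B.series_in_H[OF x(1)]]
          orth_proj_Yk[OF B.series_in_H[OF x(2)]] algebra_simps)
  qed
qed

end

section \<open>Critical values above every bound\<close>

theorem corollary13:
  fixes Y :: "'a::{real_inner, complete_space} set"
    and e \<theta> :: "nat \<Rightarrow> 'a"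
    and J :: "nat set"
    and G :: "('g, 'm) monoid_scheme"
    and act :: "'g \<Rightarrow> 'a \<Rightarrow> 'a"
    and \<phi> :: "'a \<Rightarrow> real"
    and \<rho> r :: "nat \<Rightarrow> real"
  assumes Y: "subspace Y" "closed Y" "\<exists>D. countable D \<and> D \<subseteq> Y \<and> Y \<subseteq> closure D"
    and e: "total_orthonormal (orthogonal_comp Y) UNIV e"
    and \<theta>: "total_orthonormal Y J \<theta>"
    and G: "group G" "finite (carrier G)"
    and act: "linear_action G act"
    and isometric: "\<forall>g\<in>carrier G. \<forall>u. norm (act g u) = norm u"
    and tau_isometric: "\<forall>g\<in>carrier G. \<forall>u. tau_norm Y J \<theta> (act g u) = tau_norm Y J \<theta> u"
    and subspaces_invariant: "\<forall>H. subspace H \<and> closed H \<longrightarrow> invariant_set G act H"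
    and admissible: "\<forall>H I b. subspace H \<and> closed H \<and> total_orthonormal H I b \<longrightarrow>
                       admissible_action G act H I b"
    and C1: "C1 \<phi>"
    and invariant: "invariant_fun G act \<phi>"
    and usc: "upper_semicontinuous (tau_topology Y J \<theta>) \<phi>"
    and grad: "weakly_seq_continuous (grad \<phi>)"
    and radii: "\<forall>k\<ge>2. \<rho> k > r k \<and> r k > 0"
    and A2: "\<forall>k\<ge>2. (SUP u\<in>{u \<in> Yk Y e k. norm u = \<rho> k}. ereal (\<phi> u)) \<le> 0"
            "\<forall>k\<ge>2. (SUP u\<in>{u \<in> Yk Y e k. norm u \<le> \<rho> k}. ereal (\<phi> u)) < \<infinity>"
    and A3: "(\<lambda>k. INF u\<in>{u \<in> Zk e k. norm u = r k}. ereal (\<phi> u)) \<longlonglongrightarrow> \<infinity>"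
    and PS: "\<forall>c>0. palais_smale \<phi> c"
  shows "\<exists>c :: nat \<Rightarrow> real. (\<forall>n. critical_value \<phi> (c n)) \<and> \<not> bounded (range c)"
proof -
  interpret fountain_space Y e \<theta> J
    using Y(1,2) e \<theta> by unfold_locales
  have act_cases: "act g = (\<lambda>u. u) \<or> act g = uminus" if g: "g \<in> carrier G" for g
  proof (rule isometry_preserving_lines)
    show "linear (act g)" "norm (act g u) = norm u" for u
      using g act isometric by (auto simp: linear_action_def)
    have "invariant_set G act (span {u})" for u
      using subspaces_invariant closed_span_singleton by blast
    then have "act g ` span {u} = span {u}" for u
      using g by (simp add: invariant_set_def)
    then show "act g u \<in> span {u}" for u
      by (metis imageI singletonI span_base)
  qed
  have adm: "admissible_action G act (span S) {..<m} b"
    if "total_orthonormal (span S) {..<m} b" for m b S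
  proof -
    have "closure (span S) = span S"
      using that unfolding total_orthonormal_def by (metis closure_closure)
    then have "closed (span S)"
      by (metis closed_closure)
    then show ?thesis
      using admissible that by blast
  qed
  \<comment> \<open>Admissibility on the line through \<open>e 0\<close> excludes nonzero fixed
    points there, so some group element acts as the negative of the identity.\<close>
  have "(\<lambda>_. e 0) ` {..<1::nat} = {e 0}"
    by blast
  then have "total_orthonormal (span {e 0}) {..<1} (\<lambda>_. e 0)"
    unfolding total_orthonormal_def using closed_span_singleton[of "e 0"] inner_e[of 0 0]
    by (simp only: closure_closed) auto
  then have "{u \<in> span {e 0}. \<forall>g\<in>carrier G. act g u = u} = {0}"
    using adm by (auto simp: admissible_action_def)
  moreover have "e 0 \<noteq> 0"
    using inner_e[of 0 0] by auto
  moreover have "e 0 \<in> span {e 0}"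
    by (simp add: span_base)
  ultimately obtain g where g: "g \<in> carrier G" "act g (e 0) \<noteq> e 0"
    by blast
  then have "act g = uminus"
    using act_cases by force
  then have even: "\<phi> (- u) = \<phi> u" for u
    using invariant g(1) by (metis invariant_fun_def)
  have "\<exists>c>M. critical_value \<phi> c" for M
  proof (rule ccontr)
    assume contra: "\<not> ?thesis"
    \<comment> \<open>\<open>B\<close> is positive, so the Palais-Smale condition holds at all
      levels from \<open>B\<close> on and the boundary values, being at most 0, lie below
      \<open>B\<close>; it exceeds \<open>M\<close>, so none of these levels is critical.\<close>
    define B where "B = max M 0 + 1"
    have "\<forall>\<^sub>F k in sequentially. ereal B < (INF u\<in>{u \<in> Zk e k. norm u = r k}. ereal (\<phi> u))"
      using order_tendstoD(1)[OF A3] by simp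
    then obtain k where k: "k \<ge> 2" "ereal B < (INF u\<in>{u \<in> Zk e k. norm u = r k}. ereal (\<phi> u))"
      using eventually_ge_at_top[of 2] by (auto simp: eventually_sequentially) (meson nat_le_linear)
    have sphere: "B < \<phi> u" if "u \<in> Zk e k" "norm u = r k" for u
      using less_le_trans[OF k(2) INF_lower] that by fastforce
    have r: "0 < r k" "r k < \<rho> k"
      using radii k(1) by auto
    obtain d where d: "(SUP u\<in>{u \<in> Yk Y e k. norm u \<le> \<rho> k}. ereal (\<phi> u)) < ereal d"
      using A2(2) k(1) less_PInf_Ex_of_nat by fastforce
    have upper: "\<phi> u \<le> d" if "u \<in> Yk Y e k" "norm u \<le> \<rho> k" for u
      using le_less_trans[OF SUP_upper d] that by fastforce
    have boundary: "\<phi> u \<le> B" if "u \<in> Yk Y e k" "norm u = \<rho> k" for u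
    proof -
      have "ereal (\<phi> u) \<le> 0"
        using order_trans[OF SUP_upper A2(1)[rule_format, OF k(1)]] that by fastforce
      then show ?thesis
        by (simp add: B_def)
    qed
    interpret D: deformation_setting "Yk Y e k" "yk_index J k" "yk_basis e \<theta> k" \<phi> "\<rho> k" d
    proof (intro deformation_setting.intro deformation_setting_axioms.intro)
      show "orthonormal_family (Yk Y e k) (yk_index J k) (yk_basis e \<theta> k)"
        using total_orthonormal_Yk by unfold_locales
      show "\<rho> k > 0"
        using r by linarith
      then show "\<forall>\<^sub>F n in sequentially. \<phi> (series (yk_basis e \<theta> k) (x n) - w n) < c"
        if "\<And>n. x n \<in> coord_ball (yk_index J k) (\<rho> k)" "y \<in> coord_ball (yk_index J k) (\<rho> k)"
          "x \<longlonglongrightarrow> y" "w \<longlonglongrightarrow> v" "\<phi> (series (yk_basis e \<theta> k) y - v) < c" for x y w v c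
        using usc_Yk[OF usc _ that] by blast
    qed (use C1 even grad upper in \<open>auto simp: C1_def\<close>)
    have "palais_smale \<phi> c \<and> \<not> critical_value \<phi> c" if "B \<le> c" for c
      using that PS contra by (auto simp: B_def)
    then obtain \<delta> where \<delta>: "\<delta> > 0" "\<And>v. B \<le> \<phi> v \<Longrightarrow> \<phi> v \<le> d \<Longrightarrow> \<delta> \<le> norm (grad \<phi> v)"
      using gradient_bound_of_palais_smale[OF C1, of B d] by blast
    have "B < D.peak g" if "g \<in> D.deformations" for g
    proof (rule D.peak_gt[OF that _ r act_cases])
      show "0 \<in> yk_index J k"
        by (simp add: yk_index_def)
    qed (use adm boundary sphere in_Zk_if_orthogonal in blast)+
    then show False
      using D.peak_lower_bound_false \<delta> by blast
  qed
  then have "\<forall>n::nat. \<exists>c. real n < c \<and> critical_value \<phi> c"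
    by blast
  then obtain c where c: "\<And>n::nat. real n < c n" "\<And>n. critical_value \<phi> (c n)"
    using choice by metis
  have "\<not> bounded (range c)"
  proof
    assume "bounded (range c)"
    then obtain K where "\<And>n. \<bar>c n\<bar> \<le> K"
      by (auto simp: bounded_iff)
    then have "real n < K" for n
      using c(1)[of n] by (meson abs_ge_self less_le_trans order_trans)
    then show False
      using reals_Archimedean2[of K] by (meson less_asym)
  qed
  then show ?thesis
    using c(2) by blast
qed

end
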